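(* Let $0<r<1$ and let $n\ge 2$ be an integer. The Toeplitz operator $T_{z^n}:H^2(A_r)\to H^2(A_r)$, $T_{z^n}f=z^nf$, has exactly $2^n$ reducing subspaces, and its minimal reducing subspaces are $\mathbb{S}_0,\dots,\mathbb{S}_{n-1}$.
   Context: $A_r=\{z\in\mathbb{C}: r<|z|<1\}$. The Hardy space $H^2(A_r)$ is the closure in $L^2(m)$ of the space $R(A_r)$ of rational functions with poles outside the closure of $A_r$, where $m$ is linear Lebesgue measure on the boundary $\partial A_r$. For $0\le k<n$, $\mathbb{S}_k$ is the closed subspace of $H^2(A_r)$ generated by the functions $z^m$, $m\in\mathbb{Z}$, $m\equiv k\pmod n$. A reducing subspace of an operator $T$ is a closed subspace invariant under both $T$ and $T^*$ (the zero subspace and the whole space are counted); a minimal reducing subspace is a nonzero reducing subspace containing no reducing subspace other than $\{0\}$ and itself. *)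

theory Defs
  imports
    "HOL-Analysis.Analysis"
    "HOL-Computational_Algebra.Polynomial"
    "HOL-Number_Theory.Cong"
begin

section \<open>The Hilbert space of square-integrable functions modulo null sets\<close>

definition L2_fun :: "'a measure \<Rightarrow> ('a \<Rightarrow> complex) set" where
  "L2_fun M = {f \<in> borel_measurable M. integrable M (\<lambda>x. (cmod (f x))\<^sup>2)}"

definition L2_class :: "'a measure \<Rightarrow> ('a \<Rightarrow> complex) \<Rightarrow> ('a \<Rightarrow> complex) set" where
  "L2_class M f = {g \<in> L2_fun M. AE x in M. g x = f x}"

definition L2 :: "'a measure \<Rightarrow> ('a \<Rightarrow> complex) set set" where
  "L2 M = L2_class M ` L2_fun M"

text \<open>The operations below are computed on an arbitrary representative; on \<^term>\<open>L2 M\<close>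
  none of them depends on which one is chosen.\<close>

definition L2_rep :: "('a \<Rightarrow> complex) set \<Rightarrow> 'a \<Rightarrow> complex" where
  "L2_rep F = (SOME f. f \<in> F)"

definition L2_zero :: "'a measure \<Rightarrow> ('a \<Rightarrow> complex) set" where
  "L2_zero M = L2_class M (\<lambda>_. 0)"

definition L2_add ::
  "'a measure \<Rightarrow> ('a \<Rightarrow> complex) set \<Rightarrow> ('a \<Rightarrow> complex) set \<Rightarrow> ('a \<Rightarrow> complex) set" where
  "L2_add M F G = L2_class M (\<lambda>x. L2_rep F x + L2_rep G x)"

definition L2_scale ::
  "'a measure \<Rightarrow> complex \<Rightarrow> ('a \<Rightarrow> complex) set \<Rightarrow> ('a \<Rightarrow> complex) set" where
  "L2_scale M c F = L2_class M (\<lambda>x. c * L2_rep F x)"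

definition L2_inner ::
  "'a measure \<Rightarrow> ('a \<Rightarrow> complex) set \<Rightarrow> ('a \<Rightarrow> complex) set \<Rightarrow> complex" where
  "L2_inner M F G = (\<integral>x. L2_rep F x * cnj (L2_rep G x) \<partial>M)"

definition L2_dist ::
  "'a measure \<Rightarrow> ('a \<Rightarrow> complex) set \<Rightarrow> ('a \<Rightarrow> complex) set \<Rightarrow> real" where
  "L2_dist M F G = sqrt (\<integral>x. (cmod (L2_rep F x - L2_rep G x))\<^sup>2 \<partial>M)"

definition L2_closure ::
  "'a measure \<Rightarrow> ('a \<Rightarrow> complex) set set \<Rightarrow> ('a \<Rightarrow> complex) set set" where
  "L2_closure M S = {F \<in> L2 M. \<forall>e>0. \<exists>G\<in>S. L2_dist M F G < e}"

definition closed_subspace :: "'a measure \<Rightarrow> ('a \<Rightarrow> complex) set set \<Rightarrow> bool" where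
  "closed_subspace M S \<longleftrightarrow>
     S \<subseteq> L2 M \<and> L2_zero M \<in> S \<and>
     (\<forall>F\<in>S. \<forall>G\<in>S. L2_add M F G \<in> S) \<and>
     (\<forall>c. \<forall>F\<in>S. L2_scale M c F \<in> S) \<and>
     L2_closure M S = S"

section \<open>Adjoints and reducing subspaces\<close>

text \<open>Here \<open>H\<close> is a closed subspace of \<^term>\<open>L2 M\<close>, regarded as a Hilbert space in its own right,
  and \<open>T\<close> is a bounded linear operator on \<open>H\<close>; the values of \<open>T\<close> outside \<open>H\<close> play no role.
  In particular the adjoint is taken in \<open>H\<close>, not in \<^term>\<open>L2 M\<close>.\<close>

definition adjoint_in ::
  "'a measure \<Rightarrow> ('a \<Rightarrow> complex) set set \<Rightarrow>
   (('a \<Rightarrow> complex) set \<Rightarrow> ('a \<Rightarrow> complex) set) \<Rightarrow>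
   ('a \<Rightarrow> complex) set \<Rightarrow> ('a \<Rightarrow> complex) set" where
  "adjoint_in M H T G = (THE K. K \<in> H \<and> (\<forall>F\<in>H. L2_inner M (T F) G = L2_inner M F K))"

definition reducing_subspace ::
  "'a measure \<Rightarrow> ('a \<Rightarrow> complex) set set \<Rightarrow>
   (('a \<Rightarrow> complex) set \<Rightarrow> ('a \<Rightarrow> complex) set) \<Rightarrow> ('a \<Rightarrow> complex) set set \<Rightarrow> bool" where
  "reducing_subspace M H T S \<longleftrightarrow>
     closed_subspace M S \<and> S \<subseteq> H \<and>
     (\<forall>F\<in>S. T F \<in> S) \<and> (\<forall>F\<in>S. adjoint_in M H T F \<in> S)"

definition minimal_reducing_subspace ::
  "'a measure \<Rightarrow> ('a \<Rightarrow> complex) set set \<Rightarrow>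
   (('a \<Rightarrow> complex) set \<Rightarrow> ('a \<Rightarrow> complex) set) \<Rightarrow> ('a \<Rightarrow> complex) set set \<Rightarrow> bool" where
  "minimal_reducing_subspace M H T S \<longleftrightarrow>
     reducing_subspace M H T S \<and> S \<noteq> {L2_zero M} \<and>
     (\<forall>S'. reducing_subspace M H T S' \<and> S' \<subseteq> S \<longrightarrow> S' = {L2_zero M} \<or> S' = S)"

section \<open>The Hardy space of the annulus\<close>

definition annulus :: "real \<Rightarrow> complex set" where
  "annulus r = {z. r < cmod z \<and> cmod z < 1}"

text \<open>Arc length on the circle of radius \<open>\<rho> > 0\<close> around the origin, as a Borel measure on the plane.\<close>

definition circle_measure :: "real \<Rightarrow> complex measure" where
  "circle_measure \<rho> =
     scale_measure (ennreal \<rho>)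
       (distr (restrict_space lborel {0..<2 * pi}) borel (\<lambda>t. of_real \<rho> * cis t))"

text \<open>For \<open>0 < r < 1\<close> the boundary of the annulus consists of the circles of radius \<open>1\<close> and \<open>r\<close>.\<close>

definition boundary_measure :: "real \<Rightarrow> complex measure" where
  "boundary_measure r =
     measure_of UNIV (sets borel)
       (\<lambda>E. emeasure (circle_measure 1) E + emeasure (circle_measure r) E)"

lemma sets_circle_measure [simp]: "sets (circle_measure \<rho>) = sets borel"
  by (simp add: circle_measure_def)

lemma space_boundary_measure [simp]: "space (boundary_measure r) = UNIV"
  by (simp add: boundary_measure_def)

lemma sets_boundary_measure [simp]: "sets (boundary_measure r) = sets borel"
  unfolding boundary_measure_def
  by (metis sets.sigma_sets_eq sets_measure_of space_borel subset_UNIV Pow_UNIV)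

lemma emeasure_circle_measure:
  assumes "E \<in> sets borel"
  shows "emeasure (circle_measure \<rho>) E =
    ennreal \<rho> * emeasure lborel {t \<in> {0..<2 * pi}. of_real \<rho> * cis t \<in> E}"
proof -
  have m: "(\<lambda>t. of_real \<rho> * cis t) \<in> borel_measurable (restrict_space lborel {0..<2 * pi})"
    by (intro measurable_restrict_space1) (simp add: borel_measurable_continuous_onI continuous_intros)
  show ?thesis
    using assms by (auto simp: circle_measure_def emeasure_distr[OF m] emeasure_restrict_space
        space_restrict_space intro!: arg_cong2[of _ _ _ _ "(*)"] arg_cong2[of _ _ _ _ emeasure])
qed

lemma emeasure_boundary_measure:
  assumes "E \<in> sets borel"
  shows "emeasure (boundary_measure r) E =
    emeasure (circle_measure 1) E + emeasure (circle_measure r) E"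
proof (rule emeasure_measure_of[OF boundary_measure_def])
  show "E \<in> sets (boundary_measure r)"
    using assms by simp
  show "positive (sets (boundary_measure r))
          (\<lambda>E. emeasure (circle_measure 1) E + emeasure (circle_measure r) E)"
    by (simp add: positive_def)
  show "countably_additive (sets (boundary_measure r))
          (\<lambda>E. emeasure (circle_measure 1) E + emeasure (circle_measure r) E)"
    unfolding countably_additive_def
  proof safe
    fix A :: "nat \<Rightarrow> complex set"
    assume A: "range A \<subseteq> sets (boundary_measure r)" "disjoint_family A"
    then show "(\<Sum>i. emeasure (circle_measure 1) (A i) + emeasure (circle_measure r) (A i)) =
      emeasure (circle_measure 1) (\<Union> (range A)) + emeasure (circle_measure r) (\<Union> (range A))"
      by (subst suminf_add[symmetric]) (auto simp: suminf_emeasure)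
  qed
qed auto

definition rational_functions :: "real \<Rightarrow> (complex \<Rightarrow> complex) set" where
  "rational_functions r =
     {\<lambda>z. poly p z / poly q z | p q. \<forall>z \<in> closure (annulus r). poly q z \<noteq> 0}"

definition hardy_space :: "real \<Rightarrow> (complex \<Rightarrow> complex) set set" where
  "hardy_space r =
     L2_closure (boundary_measure r) (L2_class (boundary_measure r) ` rational_functions r)"

definition toeplitz_power ::
  "real \<Rightarrow> nat \<Rightarrow> (complex \<Rightarrow> complex) set \<Rightarrow> (complex \<Rightarrow> complex) set" where
  "toeplitz_power r n F = L2_class (boundary_measure r) (\<lambda>z. z ^ n * L2_rep F z)"

definition residue_subspace :: "real \<Rightarrow> nat \<Rightarrow> nat \<Rightarrow> (complex \<Rightarrow> complex) set set" where
  "residue_subspace r n k =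
     \<Inter> {S. closed_subspace (boundary_measure r) S \<and> S \<subseteq> hardy_space r \<and>
            (\<forall>m::int. [m = int k] (mod int n) \<longrightarrow>
               L2_class (boundary_measure r) (\<lambda>z. z powi m) \<in> S)}"

end

theory Submission
  imports Defs "HOL-Computational_Algebra.Fundamental_Theorem_Algebra"
begin

text \<open>The monomials \<open>z\<^sup>m\<close>, \<open>m \<in> \<int>\<close>, are pairwise orthogonal in \<open>L\<^sup>2\<close> of the two boundary circles, with
  \<open>\<parallel>z\<^sup>m\<parallel>\<^sup>2 = 2\<pi>(1 + r\<^bsup>2m+1\<^esup>)\<close> (lemma \<open>inner_zpow\<close>), and their closed span is the Hardy space
  (lemma \<open>hardy_least\<close>): by geometric series for the linear factors of its denominator, every rational
  function without poles on the closed annulus is a uniform limit of Laurent polynomials there. In this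
  orthogonal basis the operator \<open>T\<close> of multiplication by \<open>z\<^sup>n\<close> is a weighted shift by \<open>n\<close> places, its
  adjoint is a weighted shift back, and \<open>T\<^sup>*T\<close> is diagonal with eigenvalues
  \<open>(1 + r\<^bsup>2m+2n+1\<^esup>) / (1 + r\<^bsup>2m+1\<^esup>)\<close>.

  These eigenvalues are pairwise distinct: they are the values of \<open>x \<mapsto> (1 + cx) / (1 + x)\<close>, with
  \<open>c = r\<^bsup>2n\<^esup> < 1\<close>, at the distinct points \<open>r\<^bsup>2m+1\<^esup>\<close>, and that function is injective for \<open>x > 0\<close>.
  On the disc all the eigenvalues would be \<open>1\<close>; it is the inner circle that separates them. Hence the
  orthogonal projection of \<open>z\<^sup>m\<close> to a reducing subspace \<open>S\<close>, being an eigenvector of \<open>T\<^sup>*T\<close> for the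
  \<open>m\<close>-th eigenvalue, is a multiple of \<open>z\<^sup>m\<close>, so that \<open>z\<^sup>m\<close> either lies in \<open>S\<close> or is orthogonal to \<open>S\<close>
  (lemma \<open>reducing_zpow_dichotomy\<close>). Therefore \<open>S\<close> is the closed span of the monomials that it contains.
  The set of their exponents is invariant under the shifts by \<open>n\<close> and \<open>-n\<close>, that is, a union of residue
  classes modulo \<open>n\<close>, and every such union occurs. So the reducing subspaces form a lattice isomorphic to
  that of the subsets of \<open>{0, \<dots>, n - 1}\<close>, whose atoms are the singletons.

  The geometry of Hilbert space enters through the orthogonal projection to a closed subspace
  (lemma \<open>projection\<close>), which rests on the completeness of \<open>L\<^sup>2\<close> (lemma \<open>L2_complete\<close>). It yields
  the adjoint of \<open>T\<close> on the Hardy space as well, and it makes expansions in Fourier series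
  unnecessary: comparing inner products with all \<open>z\<^sup>m\<close> is enough to identify an element of the Hardy
  space (lemma \<open>hardy_eqI\<close>).\<close>


section \<open>Square-integrable functions and their classes\<close>

abbreviation sqnorm :: "'a measure \<Rightarrow> ('a \<Rightarrow> complex) \<Rightarrow> real" where
  "sqnorm M f \<equiv> (\<integral>x. (cmod (f x))\<^sup>2 \<partial>M)"

lemma borel_measurable_cnj [measurable]: "cnj \<in> borel_measurable borel"
  by (intro borel_measurable_continuous_onI continuous_intros)

text \<open>This estimate and \<open>cmod_mult_le_weighted\<close> are \<open>0 \<le> (t|a| - |b|)\<^sup>2 / t\<close> written out. Integrated and with \<open>t\<close> chosen
  small, large or equal to \<open>1\<close> as the occasion demands, they do the work of the Minkowski and
  Cauchy-Schwarz inequalities.\<close>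

lemma cmod_add_sq_le_weighted:
  assumes "t > 0"
  shows "(cmod (a + b))\<^sup>2 \<le> (1 + t) * (cmod a)\<^sup>2 + (1 + 1 / t) * (cmod b)\<^sup>2"
proof -
  have "0 \<le> (t * cmod a - cmod b)\<^sup>2 / t"
    using assms by simp
  also have "\<dots> = t * (cmod a)\<^sup>2 + (1 / t) * (cmod b)\<^sup>2 - 2 * cmod a * cmod b"
    using assms by (simp add: field_simps power2_eq_square)
  finally have "(cmod a + cmod b)\<^sup>2 \<le> (1 + t) * (cmod a)\<^sup>2 + (1 + 1 / t) * (cmod b)\<^sup>2"
    by (simp add: power2_sum algebra_simps)
  moreover have "(cmod (a + b))\<^sup>2 \<le> (cmod a + cmod b)\<^sup>2"
    by (intro power_mono norm_triangle_ineq) simp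
  ultimately show ?thesis by linarith
qed

lemma cmod_add_sq_le: "(cmod (a + b))\<^sup>2 \<le> 2 * (cmod a)\<^sup>2 + 2 * (cmod b)\<^sup>2"
  using cmod_add_sq_le_weighted[of 1 a b] by simp

lemma cmod_mult_le_weighted:
  assumes "t > 0"
  shows "cmod (a * b) \<le> (t * (cmod a)\<^sup>2 + (cmod b)\<^sup>2 / t) / 2"
proof -
  have "0 \<le> (t * cmod a - cmod b)\<^sup>2 / t"
    using assms by simp
  also have "\<dots> = t * (cmod a)\<^sup>2 + (1 / t) * (cmod b)\<^sup>2 - 2 * cmod a * cmod b"
    using assms by (simp add: field_simps power2_eq_square)
  finally show ?thesis
    by (simp add: norm_mult)
qed

lemma L2_fun_measurable [measurable_dest]: "f \<in> L2_fun M \<Longrightarrow> f \<in> borel_measurable M"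
  by (simp add: L2_fun_def)

lemma L2_fun_integrable: "f \<in> L2_fun M \<Longrightarrow> integrable M (\<lambda>x. (cmod (f x))\<^sup>2)"
  by (simp add: L2_fun_def)

lemma L2_funI_bound:
  assumes "f \<in> borel_measurable M" "integrable M g" "AE x in M. (cmod (f x))\<^sup>2 \<le> g x"
  shows "f \<in> L2_fun M"
  using assms unfolding L2_fun_def
  by (auto intro!: Bochner_Integration.integrable_bound[of M g])

lemma L2_fun_zero [simp]: "(\<lambda>_. 0) \<in> L2_fun M"
  by (simp add: L2_fun_def)

lemma L2_fun_add [simp]:
  assumes "f \<in> L2_fun M" "g \<in> L2_fun M"
  shows "(\<lambda>x. f x + g x) \<in> L2_fun M"
  by (rule L2_funI_bound[of _ _ "\<lambda>x. 2 * (cmod (f x))\<^sup>2 + 2 * (cmod (g x))\<^sup>2"])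
     (use assms cmod_add_sq_le in \<open>auto simp: L2_fun_def\<close>)

lemma L2_fun_scale [simp]: "f \<in> L2_fun M \<Longrightarrow> (\<lambda>x. c * f x) \<in> L2_fun M"
  by (auto simp: L2_fun_def norm_mult power_mult_distrib)

lemma L2_fun_diff [simp]:
  assumes "f \<in> L2_fun M" "g \<in> L2_fun M"
  shows "(\<lambda>x. f x - g x) \<in> L2_fun M"
  using L2_fun_add[OF assms(1) L2_fun_scale[OF assms(2), of "-1"]] by simp

lemma L2_fun_integrable_mult [simp]:
  assumes "f \<in> L2_fun M" "g \<in> L2_fun M"
  shows "integrable M (\<lambda>x. f x * cnj (g x))"
proof (rule Bochner_Integration.integrable_bound)
  show "integrable M (\<lambda>x. ((cmod (f x))\<^sup>2 + (cmod (g x))\<^sup>2) / 2)"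
    using assms by (auto simp: L2_fun_def)
  show "AE x in M. norm (f x * cnj (g x)) \<le> norm (((cmod (f x))\<^sup>2 + (cmod (g x))\<^sup>2) / 2)"
    using cmod_mult_le_weighted[of 1 "f x" "cnj (g x)" for x] by (intro AE_I2) simp
qed (use assms in \<open>auto simp: L2_fun_def\<close>)

lemma L2_class_self: "f \<in> L2_fun M \<Longrightarrow> f \<in> L2_class M f"
  by (simp add: L2_class_def)

lemma L2_class_in_L2 [simp]: "f \<in> L2_fun M \<Longrightarrow> L2_class M f \<in> L2 M"
  by (simp add: L2_def)

text \<open>No integrability is required: the class consists of the square-integrable functions that agree
  almost everywhere with the given one, whatever that is. This is what turns every operation on
  representatives into the corresponding operation on classes.\<close>

lemma L2_class_cong_AE: "AE x in M. f x = g x \<Longrightarrow> L2_class M f = L2_class M g"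
  unfolding L2_class_def by (intro Collect_cong conj_cong refl) (auto elim: AE_mp)

lemma L2_rep_class:
  assumes "f \<in> L2_fun M"
  shows "L2_rep (L2_class M f) \<in> L2_fun M" "AE x in M. L2_rep (L2_class M f) x = f x"
proof -
  have "L2_rep (L2_class M f) \<in> L2_class M f"
    unfolding L2_rep_def using L2_class_self[OF assms] by (metis someI)
  then show "L2_rep (L2_class M f) \<in> L2_fun M" "AE x in M. L2_rep (L2_class M f) x = f x"
    by (auto simp: L2_class_def)
qed

lemma L2_cases:
  assumes "F \<in> L2 M"
  obtains f where "f \<in> L2_fun M" "F = L2_class M f"
  using assms by (auto simp: L2_def)

lemma L2_add_class:
  assumes "f \<in> L2_fun M" "g \<in> L2_fun M"
  shows "L2_add M (L2_class M f) (L2_class M g) = L2_class M (\<lambda>x. f x + g x)"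
  unfolding L2_add_def
  using L2_rep_class[OF assms(1)] L2_rep_class[OF assms(2)] by (intro L2_class_cong_AE) auto

lemma L2_scale_class:
  assumes "f \<in> L2_fun M"
  shows "L2_scale M c (L2_class M f) = L2_class M (\<lambda>x. c * f x)"
  unfolding L2_scale_def using L2_rep_class[OF assms] by (intro L2_class_cong_AE) auto

lemma L2_inner_class:
  assumes f: "f \<in> L2_fun M" and g: "g \<in> L2_fun M"
  shows "L2_inner M (L2_class M f) (L2_class M g) = (\<integral>x. f x * cnj (g x) \<partial>M)"
proof -
  note [measurable] = L2_rep_class(1)[OF f] L2_rep_class(1)[OF g] f g
  show ?thesis
    unfolding L2_inner_def using L2_rep_class(2)[OF f] L2_rep_class(2)[OF g]
    by (intro integral_cong_AE) (measurable, auto)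
qed

lemma L2_dist_class:
  assumes f: "f \<in> L2_fun M" and g: "g \<in> L2_fun M"
  shows "L2_dist M (L2_class M f) (L2_class M g) = sqrt (sqnorm M (\<lambda>x. f x - g x))"
proof -
  note [measurable] = L2_rep_class(1)[OF f] L2_rep_class(1)[OF g] f g
  show ?thesis
    unfolding L2_dist_def using L2_rep_class(2)[OF f] L2_rep_class(2)[OF g]
    by (intro arg_cong[of _ _ sqrt] integral_cong_AE) (measurable, auto)
qed

lemma L2_dist_class_less_iff:
  assumes "f \<in> L2_fun M" "g \<in> L2_fun M" "e > 0"
  shows "L2_dist M (L2_class M f) (L2_class M g) < e \<longleftrightarrow> sqnorm M (\<lambda>x. f x - g x) < e\<^sup>2"
  using assms real_sqrt_less_iff[of "sqnorm M (\<lambda>x. f x - g x)" "e\<^sup>2"]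
  by (simp add: L2_dist_class del: real_sqrt_less_iff)

lemma L2_zero_in_L2 [simp]: "L2_zero M \<in> L2 M"
  by (simp add: L2_zero_def)

lemma L2_add_in_L2 [simp]: "F \<in> L2 M \<Longrightarrow> G \<in> L2 M \<Longrightarrow> L2_add M F G \<in> L2 M"
  by (auto elim!: L2_cases simp: L2_add_class)

lemma L2_scale_in_L2 [simp]: "F \<in> L2 M \<Longrightarrow> L2_scale M c F \<in> L2 M"
  by (auto elim!: L2_cases simp: L2_scale_class)

lemma L2_inner_zero_left [simp]: "G \<in> L2 M \<Longrightarrow> L2_inner M (L2_zero M) G = 0"
  unfolding L2_zero_def by (auto elim!: L2_cases simp: L2_inner_class)

lemma L2_inner_add_left:
  assumes "F \<in> L2 M" "G \<in> L2 M" "K \<in> L2 M"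
  shows "L2_inner M (L2_add M F G) K = L2_inner M F K + L2_inner M G K"
  using assms by (auto elim!: L2_cases simp: L2_inner_class L2_add_class ring_distribs)

lemma L2_inner_scale_left:
  assumes "F \<in> L2 M" "K \<in> L2 M"
  shows "L2_inner M (L2_scale M c F) K = c * L2_inner M F K"
  using assms by (auto elim!: L2_cases simp: L2_inner_class L2_scale_class mult.assoc)

lemma L2_inner_commute:
  assumes "F \<in> L2 M" "G \<in> L2 M"
  shows "L2_inner M F G = cnj (L2_inner M G F)"
proof -
  obtain f g where "f \<in> L2_fun M" "F = L2_class M f" "g \<in> L2_fun M" "G = L2_class M g"
    using assms by (auto elim!: L2_cases)
  then show ?thesis
    by (simp add: L2_inner_class mult.commute flip: Bochner_Integration.integral_cnj)
qed

lemma L2_inner_class_self: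
  assumes "f \<in> L2_fun M"
  shows "L2_inner M (L2_class M f) (L2_class M f) = of_real (sqnorm M f)"
  using assms by (simp add: L2_inner_class complex_norm_square[symmetric] flip: of_real_power)

lemma L2_class_eq_of_sqnorm:
  assumes f: "f \<in> L2_fun M" and g: "g \<in> L2_fun M" and "sqnorm M (\<lambda>x. f x - g x) = 0"
  shows "L2_class M f = L2_class M g"
proof (rule L2_class_cong_AE)
  have "AE x in M. (cmod (f x - g x))\<^sup>2 = 0"
    using assms(3) L2_fun_integrable[OF L2_fun_diff[OF f g]]
    by (subst (asm) integral_nonneg_eq_0_iff_AE) auto
  then show "AE x in M. f x = g x"
    by auto
qed

section \<open>Closed subspaces\<close>

lemma closed_subspaceD:
  assumes "closed_subspace M S"
  shows "S \<subseteq> L2 M" "L2_zero M \<in> S"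
    "F \<in> S \<Longrightarrow> G \<in> S \<Longrightarrow> L2_add M F G \<in> S"
    "F \<in> S \<Longrightarrow> L2_scale M c F \<in> S"
    "L2_closure M S = S"
  using assms by (auto simp: closed_subspace_def)

lemma L2_closure_superset: 
  assumes "S \<subseteq> L2 M" 
  shows "S \<subseteq> L2_closure M S"
proof
  fix F assume F: "F \<in> S"
  then have "L2_dist M F F = 0"
    by (simp add: L2_dist_def)
  with F assms show "F \<in> L2_closure M S"
    unfolding L2_closure_def by (auto intro!: bexI[of _ F])
qed

lemma L2_closure_mono: "S \<subseteq> S' \<Longrightarrow> L2_closure M S \<subseteq> L2_closure M S'"
  unfolding L2_closure_def by blast

lemma closed_subspaceI:
  assumes "S \<subseteq> L2 M" "L2_zero M \<in> S"
    "\<And>F G. F \<in> S \<Longrightarrow> G \<in> S \<Longrightarrow> L2_add M F G \<in> S"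
    "\<And>c F. F \<in> S \<Longrightarrow> L2_scale M c F \<in> S"
    "L2_closure M S \<subseteq> S"
  shows "closed_subspace M S"
  using assms L2_closure_superset[of S M] unfolding closed_subspace_def by blast

lemma closed_subspace_Inter:
  assumes "\<And>S. S \<in> \<S> \<Longrightarrow> closed_subspace M S" "\<S> \<noteq> {}"
  shows "closed_subspace M (\<Inter>\<S>)"
proof (rule closed_subspaceI)
  show "L2_closure M (\<Inter>\<S>) \<subseteq> \<Inter>\<S>"
  proof (rule Inter_greatest)
    fix S assume "S \<in> \<S>"
    then show "L2_closure M (\<Inter>\<S>) \<subseteq> S"
      using L2_closure_mono[of "\<Inter>\<S>" S M] closed_subspaceD(5)[OF assms(1)] by auto
  qed
  show "\<Inter>\<S> \<subseteq> L2 M"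
    using assms(2) closed_subspaceD(1)[OF assms(1)] by auto
qed (auto intro: closed_subspaceD[OF assms(1)])

lemma closed_subspace_Int:
  "closed_subspace M S \<Longrightarrow> closed_subspace M S' \<Longrightarrow> closed_subspace M (S \<inter> S')"
  using closed_subspace_Inter[of "{S, S'}" M] by auto

lemma closed_subspace_class_diff:
  assumes S: "closed_subspace M S" and f: "f \<in> L2_fun M" "L2_class M f \<in> S"
    and g: "g \<in> L2_fun M" "L2_class M g \<in> S"
  shows "L2_class M (\<lambda>x. f x - g x) \<in> S"
proof -
  have "L2_add M (L2_class M f) (L2_scale M (-1) (L2_class M g)) \<in> S"
    using assms closed_subspaceD[OF S] by blast
  then show ?thesis
    using f g L2_fun_scale[OF g(1), of "-1"] by (simp add: L2_scale_class L2_add_class)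
qed

lemma closed_subspace_class_sum:
  assumes S: "closed_subspace M S"
    and f: "\<And>i. i \<in> I \<Longrightarrow> f i \<in> L2_fun M" "\<And>i. i \<in> I \<Longrightarrow> L2_class M (f i) \<in> S"
  shows "(\<lambda>x. \<Sum>i\<in>I. c i * f i x) \<in> L2_fun M \<and> L2_class M (\<lambda>x. \<Sum>i\<in>I. c i * f i x) \<in> S"
  using f
proof (induction I rule: infinite_finite_induct)
  case (insert i I)
  have "L2_add M (L2_scale M (c i) (L2_class M (f i))) (L2_class M (\<lambda>x. \<Sum>i\<in>I. c i * f i x)) \<in> S"
    using insert closed_subspaceD[OF S] by auto
  with insert show ?case
    by (simp add: L2_scale_class L2_add_class)
qed (use closed_subspaceD(2)[OF S] in \<open>simp_all add: L2_zero_def\<close>)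

lemma sqnorm_triangle_weighted:
  assumes "f \<in> L2_fun M" "g \<in> L2_fun M" "h \<in> L2_fun M" "t > 0"
  shows "sqnorm M (\<lambda>x. f x - h x) \<le> (1 + t) * sqnorm M (\<lambda>x. f x - g x) + (1 + 1 / t) * sqnorm M (\<lambda>x. g x - h x)"
proof -
  have "sqnorm M (\<lambda>x. f x - h x) \<le> (\<integral>x. (1 + t) * (cmod (f x - g x))\<^sup>2 + (1 + 1 / t) * (cmod (g x - h x))\<^sup>2 \<partial>M)"
    using assms cmod_add_sq_le_weighted[of t "f x - g x" "g x - h x" for x]
    by (intro integral_mono Bochner_Integration.integrable_add integrable_mult_right L2_fun_integrable) auto
  also have "\<dots> = (1 + t) * sqnorm M (\<lambda>x. f x - g x) + (1 + 1 / t) * sqnorm M (\<lambda>x. g x - h x)"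
    using assms by (subst Bochner_Integration.integral_add) (auto intro!: L2_fun_integrable integrable_mult_right)
  finally show ?thesis .
qed

lemma sqnorm_triangle:
  assumes "f \<in> L2_fun M" "g \<in> L2_fun M" "h \<in> L2_fun M"
  shows "sqnorm M (\<lambda>x. f x - h x) \<le> 2 * sqnorm M (\<lambda>x. f x - g x) + 2 * sqnorm M (\<lambda>x. g x - h x)"
  using sqnorm_triangle_weighted[OF assms, of 1] by simp

text \<open>Membership in a closure, and its introduction below, in terms of functions and the squared norm, so that
  estimates can be made pointwise under the integral.\<close>

lemma L2_closure_classE:
  assumes "F \<in> L2_closure M S" "S \<subseteq> L2 M"
  obtains f where "f \<in> L2_fun M" "F = L2_class M f"
    "\<And>e. e > 0 \<Longrightarrow> \<exists>g. g \<in> L2_fun M \<and> L2_class M g \<in> S \<and> sqnorm M (\<lambda>x. f x - g x) < e"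
proof -
  obtain f where f: "f \<in> L2_fun M" "F = L2_class M f"
    using assms by (auto simp: L2_closure_def elim: L2_cases)
  have approx: "\<exists>g. g \<in> L2_fun M \<and> L2_class M g \<in> S \<and> sqnorm M (\<lambda>x. f x - g x) < e" if "e > 0" for e
  proof -
    obtain G where "G \<in> S" "L2_dist M F G < sqrt e"
      using assms \<open>e > 0\<close> unfolding L2_closure_def by (auto dest!: spec[of _ "sqrt e"])
    moreover obtain g where "g \<in> L2_fun M" "G = L2_class M g"
      using assms(2) \<open>G \<in> S\<close> by (auto elim: L2_cases)
    ultimately show ?thesis
      using f \<open>e > 0\<close> by (intro exI[of _ g]) (simp add: L2_dist_class_less_iff)
  qed
  show ?thesis by (rule that[OF f approx])
qed

lemma L2_closure_classI:
  assumes f: "f \<in> L2_fun M"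
    and "\<And>e. e > 0 \<Longrightarrow> \<exists>g. g \<in> L2_fun M \<and> L2_class M g \<in> S \<and> sqnorm M (\<lambda>x. f x - g x) < e"
  shows "L2_class M f \<in> L2_closure M S"
  unfolding L2_closure_def
proof (safe intro!: L2_class_in_L2[OF f])
  fix e :: real assume e: "e > 0"
  then obtain g where "g \<in> L2_fun M" "L2_class M g \<in> S" "sqnorm M (\<lambda>x. f x - g x) < e\<^sup>2"
    using assms(2)[of "e\<^sup>2"] by auto
  then show "\<exists>G\<in>S. L2_dist M (L2_class M f) G < e"
    using f e by (intro bexI[of _ "L2_class M g"]) (simp_all add: L2_dist_class_less_iff)
qed

lemma sqnorm_scale: "sqnorm M (\<lambda>x. c * f x) = (cmod c)\<^sup>2 * sqnorm M f"
  by (simp add: norm_mult power_mult_distrib)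

lemma closed_subspace_closure:
  assumes S: "S \<subseteq> L2 M" "L2_zero M \<in> S"
    and add: "\<And>F G. F \<in> S \<Longrightarrow> G \<in> S \<Longrightarrow> L2_add M F G \<in> S"
    and scale: "\<And>c F. F \<in> S \<Longrightarrow> L2_scale M c F \<in> S"
  shows "closed_subspace M (L2_closure M S)"
proof (rule closed_subspaceI)
  show "L2_closure M S \<subseteq> L2 M" 
    by (auto simp: L2_closure_def)
  then have cl: "L2_closure M S \<subseteq> L2 M" .
  show "L2_zero M \<in> L2_closure M S"
    using S L2_closure_superset by blast
  show "L2_add M F G \<in> L2_closure M S" if F: "F \<in> L2_closure M S" and G: "G \<in> L2_closure M S" for F G
  proof -
    obtain f where f: "f \<in> L2_fun M" "F = L2_class M f"
      and fa: "\<And>e. e > 0 \<Longrightarrow> \<exists>g. g \<in> L2_fun M \<and> L2_class M g \<in> S \<and> sqnorm M (\<lambda>x. f x - g x) < e"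
      by (rule L2_closure_classE[OF F S(1)]) blast
    obtain g where g: "g \<in> L2_fun M" "G = L2_class M g"
      and ga: "\<And>e. e > 0 \<Longrightarrow> \<exists>h. h \<in> L2_fun M \<and> L2_class M h \<in> S \<and> sqnorm M (\<lambda>x. g x - h x) < e"
      by (rule L2_closure_classE[OF G S(1)]) blast
    have "L2_class M (\<lambda>x. f x + g x) \<in> L2_closure M S"
    proof (rule L2_closure_classI)
      fix e :: real assume "e > 0"
      then obtain f' g' where f': "f' \<in> L2_fun M" "L2_class M f' \<in> S" "sqnorm M (\<lambda>x. f x - f' x) < e / 4"
        and g': "g' \<in> L2_fun M" "L2_class M g' \<in> S" "sqnorm M (\<lambda>x. g x - g' x) < e / 4"
        using fa[of "e / 4"] ga[of "e / 4"] by auto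
      have "sqnorm M (\<lambda>x. (f x + g x) - (f' x + g' x)) \<le> 2 * sqnorm M (\<lambda>x. f x - f' x) + 2 * sqnorm M (\<lambda>x. g x - g' x)"
        using sqnorm_triangle[of "\<lambda>x. f x + g x" M "\<lambda>x. f' x + g x" "\<lambda>x. f' x + g' x"] f g f' g' by simp
      also have "\<dots> < e"
        using f' g' by simp
      finally show "\<exists>h. h \<in> L2_fun M \<and> L2_class M h \<in> S \<and> sqnorm M (\<lambda>x. (f x + g x) - h x) < e"
        using f' g' add[OF f'(2) g'(2)] by (intro exI[of _ "\<lambda>x. f' x + g' x"]) (simp add: L2_add_class)
    qed (use f g in simp)
    then show ?thesis
      using f g by (simp add: L2_add_class)
  qed
  show "L2_scale M c F \<in> L2_closure M S" if F: "F \<in> L2_closure M S" for c F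
  proof -
    obtain f where f: "f \<in> L2_fun M" "F = L2_class M f"
      and fa: "\<And>e. e > 0 \<Longrightarrow> \<exists>g. g \<in> L2_fun M \<and> L2_class M g \<in> S \<and> sqnorm M (\<lambda>x. f x - g x) < e"
      by (rule L2_closure_classE[OF F S(1)]) blast
    have "L2_class M (\<lambda>x. c * f x) \<in> L2_closure M S"
    proof (rule L2_closure_classI)
      fix e :: real assume e: "e > 0"
      have pos: "(cmod c)\<^sup>2 + 1 > 0" by (simp add: add_nonneg_pos)
      then obtain f' where f': "f' \<in> L2_fun M" "L2_class M f' \<in> S"
          "sqnorm M (\<lambda>x. f x - f' x) < e / ((cmod c)\<^sup>2 + 1)"
        using fa[of "e / ((cmod c)\<^sup>2 + 1)"] e by auto
      have "sqnorm M (\<lambda>x. c * f x - c * f' x) = (cmod c)\<^sup>2 * sqnorm M (\<lambda>x. f x - f' x)"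
        by (simp add: sqnorm_scale flip: right_diff_distrib)
      also have "\<dots> \<le> ((cmod c)\<^sup>2 + 1) * sqnorm M (\<lambda>x. f x - f' x)"
        by (intro mult_right_mono) auto
      also have "\<dots> < e"
        using f'(3) pos by (simp add: field_simps)
      finally show "\<exists>h. h \<in> L2_fun M \<and> L2_class M h \<in> S \<and> sqnorm M (\<lambda>x. c * f x - h x) < e"
        using f' scale[OF f'(2), of c] by (intro exI[of _ "\<lambda>x. c * f' x"]) (simp add: L2_scale_class)
    qed (use f in simp)
    then show ?thesis
      using f by (simp add: L2_scale_class)
  qed
  show "L2_closure M (L2_closure M S) \<subseteq> L2_closure M S"
  proof
    fix F assume F: "F \<in> L2_closure M (L2_closure M S)"
    obtain f where f: "f \<in> L2_fun M" "F = L2_class M f"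
      and fa: "\<And>e. e > 0 \<Longrightarrow> \<exists>g. g \<in> L2_fun M \<and> L2_class M g \<in> L2_closure M S \<and> sqnorm M (\<lambda>x. f x - g x) < e"
      by (rule L2_closure_classE[OF F cl]) blast
    have "L2_class M f \<in> L2_closure M S"
    proof (rule L2_closure_classI[OF f(1)])
      fix e :: real assume e: "e > 0"
      then obtain g where g: "g \<in> L2_fun M" "L2_class M g \<in> L2_closure M S" "sqnorm M (\<lambda>x. f x - g x) < e / 4"
        using fa[of "e / 4"] by auto
      obtain g' where g': "g' \<in> L2_fun M" "L2_class M g' = L2_class M g"
        and ga: "\<And>e. e > 0 \<Longrightarrow> \<exists>h. h \<in> L2_fun M \<and> L2_class M h \<in> S \<and> sqnorm M (\<lambda>x. g' x - h x) < e"
        by (rule L2_closure_classE[OF g(2) S(1)]) metis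
      obtain h where h: "h \<in> L2_fun M" "L2_class M h \<in> S" "sqnorm M (\<lambda>x. g' x - h x) < e / 4"
        using ga[of "e / 4"] e by auto
      have eq: "L2_dist M (L2_class M f) (L2_class M g') = L2_dist M (L2_class M f) (L2_class M g)"
        using g' by simp
      have "sqnorm M (\<lambda>x. f x - g' x) = sqnorm M (\<lambda>x. f x - g x)"
        using eq f(1) g(1) g'(1) by (simp add: L2_dist_class)
      with sqnorm_triangle[OF f(1) g'(1) h(1)] g(3) h(3) have "sqnorm M (\<lambda>x. f x - h x) < e"
        by simp
      with h show "\<exists>g. g \<in> L2_fun M \<and> L2_class M g \<in> S \<and> sqnorm M (\<lambda>x. f x - g x) < e"
        by blast
    qed
    with f show "F \<in> L2_closure M S" by simp
  qed
qed

text \<open>Continuity of the inner product in its first argument, from the pointwise estimate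
  \<open>|ab| \<le> (|a|\<^sup>2/e + e|b|\<^sup>2) / 2\<close>.\<close>

lemma inner_diff_bound:
  assumes f: "f \<in> L2_fun M" and g: "g \<in> L2_fun M" and h: "h \<in> L2_fun M" and e: "e > 0"
    and "sqnorm M (\<lambda>x. f x - g x) < e\<^sup>2"
  shows "cmod ((\<integral>x. f x * cnj (h x) \<partial>M) - (\<integral>x. g x * cnj (h x) \<partial>M)) \<le> e * (sqnorm M h + 1)"
proof -
  have "(\<integral>x. f x * cnj (h x) \<partial>M) - (\<integral>x. g x * cnj (h x) \<partial>M) = (\<integral>x. (f x - g x) * cnj (h x) \<partial>M)"
    using f g h by (simp add: left_diff_distrib)
  also have "cmod \<dots> \<le> (\<integral>x. cmod ((f x - g x) * cnj (h x)) \<partial>M)"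
    by (rule integral_norm_bound)
  also have "\<dots> \<le> (\<integral>x. ((1 / e) * (cmod (f x - g x))\<^sup>2 + (cmod (cnj (h x)))\<^sup>2 / (1 / e)) / 2 \<partial>M)"
  proof (rule integral_mono)
    show "integrable M (\<lambda>x. ((1 / e) * (cmod (f x - g x))\<^sup>2 + (cmod (cnj (h x)))\<^sup>2 / (1 / e)) / 2)"
      using L2_fun_integrable[OF L2_fun_diff[OF f g]] L2_fun_integrable[OF h] by simp
    show "integrable M (\<lambda>x. cmod ((f x - g x) * cnj (h x)))"
      using f g h by (intro integrable_norm L2_fun_integrable_mult) simp_all
    show "cmod ((f x - g x) * cnj (h x)) \<le> ((1 / e) * (cmod (f x - g x))\<^sup>2 + (cmod (cnj (h x)))\<^sup>2 / (1 / e)) / 2" for x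
      by (rule cmod_mult_le_weighted) (use e in simp)
  qed
  also have "\<dots> = (sqnorm M (\<lambda>x. f x - g x) / e + e * sqnorm M h) / 2"
    using f g h by (simp add: L2_fun_integrable)
  also have "\<dots> \<le> (e + e * sqnorm M h) / 2"
    using assms(5) e by (simp add: field_simps power2_eq_square)
  also have "\<dots> \<le> e * (sqnorm M h + 1)"
    using e by (simp add: field_simps)
  finally show ?thesis .
qed

text \<open>Closedness comes from the continuity of the inner product. Density of the monomials, the identification
  of elements by their coefficients and the closedness of the coordinate subspaces all use this.\<close>

lemma closed_subspace_annihilator:
  assumes A: "A \<subseteq> L2 M"
  shows "closed_subspace M {F \<in> L2 M. \<forall>G\<in>A. L2_inner M F G = 0}" (is "closed_subspace M ?S")
proof (rule closed_subspaceI)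
  show "L2_closure M ?S \<subseteq> ?S"
  proof
    fix F assume F: "F \<in> L2_closure M ?S"
    obtain f where f: "f \<in> L2_fun M" "F = L2_class M f"
      and fa: "\<And>e. e > 0 \<Longrightarrow> \<exists>g. g \<in> L2_fun M \<and> L2_class M g \<in> ?S \<and> sqnorm M (\<lambda>x. f x - g x) < e"
      by (rule L2_closure_classE[OF F]) auto
    have "L2_inner M F G = 0" if "G \<in> A" for G
    proof -
      obtain h where h: "h \<in> L2_fun M" "G = L2_class M h"
        using A \<open>G \<in> A\<close> by (auto elim: L2_cases)
      have pos: "sqnorm M h + 1 > 0"
        by (simp add: add_nonneg_pos)
      have "cmod (L2_inner M F G) \<le> 0 + e" if "e > 0" for e
      proof -
        define d where "d = e / (sqnorm M h + 1)"
        have d: "d > 0"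
          using \<open>e > 0\<close> pos by (simp add: d_def)
        obtain g where g: "g \<in> L2_fun M" "L2_class M g \<in> ?S" "sqnorm M (\<lambda>x. f x - g x) < d\<^sup>2"
          using fa[of "d\<^sup>2"] d by auto
        have "L2_inner M (L2_class M g) G = 0"
          using g(2) \<open>G \<in> A\<close> by auto
        then show ?thesis
          using inner_diff_bound[OF f(1) g(1) h(1) d g(3)] f h g pos by (simp add: L2_inner_class d_def)
      qed
      then have "cmod (L2_inner M F G) \<le> 0"
        by (rule field_le_epsilon)
      then show ?thesis by simp
    qed
    with f show "F \<in> ?S" by simp
  qed
qed (use A in \<open>auto simp: L2_inner_add_left L2_inner_scale_left subset_iff\<close>)

text \<open>The difference of the two elements lies in \<open>S\<close> and is orthogonal to itself.\<close>

lemma L2_eqI: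
  assumes S: "closed_subspace M S" and F: "F \<in> S" and G: "G \<in> S"
    and eq: "\<And>K. K \<in> S \<Longrightarrow> L2_inner M F K = L2_inner M G K"
  shows "F = G"
proof -
  obtain f where f: "f \<in> L2_fun M" "F = L2_class M f"
    using F closed_subspaceD(1)[OF S] by (auto elim: L2_cases)
  obtain g where g: "g \<in> L2_fun M" "G = L2_class M g"
    using G closed_subspaceD(1)[OF S] by (auto elim: L2_cases)
  have d: "(\<lambda>x. f x - g x) \<in> L2_fun M" "L2_class M (\<lambda>x. f x - g x) \<in> S"
    using closed_subspace_class_diff[OF S] f g F G by auto
  have "of_real (sqnorm M (\<lambda>x. f x - g x)) = L2_inner M (L2_class M (\<lambda>x. f x - g x)) (L2_class M (\<lambda>x. f x - g x))"
    using d by (simp only: L2_inner_class_self)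
  also have "\<dots> = L2_inner M F (L2_class M (\<lambda>x. f x - g x)) - L2_inner M G (L2_class M (\<lambda>x. f x - g x))"
    using f g d(1) unfolding f(2) g(2)
    by (subst (1 2 3) L2_inner_class) (auto simp: left_diff_distrib simp del: complex_cnj_diff)
  also have "\<dots> = 0"
    using eq[OF d(2)] by simp
  finally have "sqnorm M (\<lambda>x. f x - g x) = 0" 
    by (simp only: of_real_eq_0_iff)
  then show ?thesis
    using L2_class_eq_of_sqnorm f g by blast
qed

section \<open>Completeness and orthogonal projection\<close>

context finite_measure
begin

lemma L2_fun_const [simp]: "(\<lambda>_. c) \<in> L2_fun M"
  by (simp add: L2_fun_def)

lemma L2_fun_integrable_self: "f \<in> L2_fun M \<Longrightarrow> integrable M f"
  using L2_fun_integrable_mult[of f M "\<lambda>_. 1"] by simp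

text \<open>On a finite measure space convergence in \<open>L\<^sup>2\<close> implies convergence in \<open>L\<^sup>1\<close>; completeness of \<open>L\<^sup>2\<close>
  is reduced to almost everywhere convergence of a subsequence through this.\<close>

lemma L1_bound:
  assumes f: "f \<in> L2_fun M" and e: "e > 0" and "sqnorm M f < e\<^sup>2"
  shows "(\<integral>x. cmod (f x) \<partial>M) \<le> e * (measure M (space M) + 1)"
proof -
  have "(\<integral>x. cmod (f x) \<partial>M) \<le> (\<integral>x. ((1 / e) * (cmod (f x))\<^sup>2 + e) / 2 \<partial>M)"
  proof (rule integral_mono)
    show "integrable M (\<lambda>x. ((1 / e) * (cmod (f x))\<^sup>2 + e) / 2)"
      using L2_fun_integrable[OF f] by simp
    show "integrable M (\<lambda>x. cmod (f x))"
      using L2_fun_integrable_self[OF f] by simp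
    show "cmod (f x) \<le> ((1 / e) * (cmod (f x))\<^sup>2 + e) / 2" for x
      using cmod_mult_le_weighted[of "1 / e" "f x" 1] e by simp
  qed
  also have "\<dots> = (sqnorm M f / e + e * measure M (space M)) / 2"
    using L2_fun_integrable[OF f] by simp
  also have "\<dots> \<le> (e + e * measure M (space M)) / 2"
    using assms(3) e by (simp add: field_simps power2_eq_square)
  also have "\<dots> \<le> e * (measure M (space M) + 1)"
    using e by (simp add: field_simps)
  finally show ?thesis .
qed

text \<open>A Cauchy sequence in \<open>L\<^sup>2\<close> is one in \<open>L\<^sup>1\<close>, so a subsequence of it converges almost everywhere;
  Fatou's lemma shows that the pointwise limit is the limit in the mean.\<close>

lemma L2_complete:
  assumes s: "\<And>k. s k \<in> L2_fun M"
    and cauchy: "\<And>e. e > 0 \<Longrightarrow> \<exists>N. \<forall>i\<ge>N. \<forall>j\<ge>N. sqnorm M (\<lambda>x. s i x - s j x) < e"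
  obtains g where "g \<in> L2_fun M" "(\<lambda>i. sqnorm M (\<lambda>x. s i x - g x)) \<longlonglongrightarrow> 0"
proof -
  have meas [measurable]: "s k \<in> borel_measurable M" for k
    using s by (simp add: L2_fun_def)
  have L1: "\<exists>N. \<forall>i\<ge>N. \<forall>j\<ge>N. (\<integral>x. norm (s i x - s j x) \<partial>M) < e" if "e > 0" for e
  proof -
    define K where "K = measure M (space M) + 1"
    define d where "d = e / (2 * K)"
    have pos: "K > 0"
      by (simp add: add_nonneg_pos K_def)
    have d: "d > 0"
      using \<open>e > 0\<close> pos by (simp add: d_def)
    obtain N where N: "\<And>i j. i \<ge> N \<Longrightarrow> j \<ge> N \<Longrightarrow> sqnorm M (\<lambda>x. s i x - s j x) < d\<^sup>2"
      using cauchy[of "d\<^sup>2"] d by auto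
    have "(\<integral>x. norm (s i x - s j x) \<partial>M) < e" if "i \<ge> N" "j \<ge> N" for i j
    proof -
      have "(\<integral>x. norm (s i x - s j x) \<partial>M) \<le> d * K"
        unfolding K_def using L1_bound[OF L2_fun_diff[OF s s] d N[OF that]] .
      also have "\<dots> = e / 2"
        using pos by (simp add: d_def)
      also have "\<dots> < e"
        using \<open>e > 0\<close> by simp
      finally show ?thesis .
    qed
    then show ?thesis by blast
  qed
  obtain r where r: "strict_mono r" "AE x in M. Cauchy (\<lambda>i. s (r i) x)"
    using cauchy_L1_AE_cauchy_subseq[of M s] L2_fun_integrable_self[OF s] L1 by blast
  define g where "g x = lim (\<lambda>i. s (r i) x)" for x
  have [measurable]: "g \<in> borel_measurable M"
    unfolding g_def by measurable
  have lim: "AE x in M. (\<lambda>i. s (r i) x) \<longlonglongrightarrow> g x"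
    using r(2) by eventually_elim (auto simp: g_def Cauchy_convergent_iff convergent_LIMSEQ_iff)
  have close: "(\<lambda>x. s i x - g x) \<in> L2_fun M \<and> sqnorm M (\<lambda>x. s i x - g x) \<le> e"
    if e: "e > 0" and N: "\<And>i j. i \<ge> N \<Longrightarrow> j \<ge> N \<Longrightarrow> sqnorm M (\<lambda>x. s i x - s j x) < e" and i: "i \<ge> N" for e N i
  proof -
    have "(\<integral>\<^sup>+x. ennreal ((cmod (s i x - g x))\<^sup>2) \<partial>M)
        = (\<integral>\<^sup>+x. liminf (\<lambda>k. ennreal ((cmod (s i x - s (r k) x))\<^sup>2)) \<partial>M)"
    proof (rule nn_integral_cong_AE)
      show "AE x in M. ennreal ((cmod (s i x - g x))\<^sup>2) = liminf (\<lambda>k. ennreal ((cmod (s i x - s (r k) x))\<^sup>2))"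
        using lim
      proof eventually_elim
        case (elim x)
        have "(\<lambda>k. ennreal ((cmod (s i x - s (r k) x))\<^sup>2)) \<longlonglongrightarrow> ennreal ((cmod (s i x - g x))\<^sup>2)"
          by (intro tendsto_ennrealI tendsto_intros elim)
        then show ?case
          using lim_imp_Liminf[OF trivial_limit_sequentially] by metis
      qed
    qed
    also have "\<dots> \<le> liminf (\<lambda>k. \<integral>\<^sup>+x. ennreal ((cmod (s i x - s (r k) x))\<^sup>2) \<partial>M)"
      by (intro nn_integral_liminf) measurable
    also have "\<dots> \<le> limsup (\<lambda>k. \<integral>\<^sup>+x. ennreal ((cmod (s i x - s (r k) x))\<^sup>2) \<partial>M)"
      by (rule Liminf_le_Limsup[OF trivial_limit_sequentially])
    also have "\<dots> \<le> ennreal e"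
    proof (rule Limsup_bounded)
      show "\<forall>\<^sub>F k in sequentially. (\<integral>\<^sup>+x. ennreal ((cmod (s i x - s (r k) x))\<^sup>2) \<partial>M) \<le> ennreal e"
        using eventually_ge_at_top[of N]
      proof eventually_elim
        case (elim k)
        then have "r k \<ge> N"
          using seq_suble[OF r(1), of k] by simp
        then have "sqnorm M (\<lambda>x. s i x - s (r k) x) \<le> e"
          using N[OF i] by (simp add: less_imp_le)
        then show ?case
          using L2_fun_integrable[OF L2_fun_diff[OF s s]] e
          by (subst nn_integral_eq_integral) (auto intro: ennreal_leI)
      qed
    qed
    finally have le: "(\<integral>\<^sup>+x. ennreal ((cmod (s i x - g x))\<^sup>2) \<partial>M) \<le> ennreal e" .
    have int: "integrable M (\<lambda>x. (cmod (s i x - g x))\<^sup>2)"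
      using le by (intro integrableI_nonneg) (auto simp: order_le_less_trans[OF _ ennreal_less_top])
    moreover have "ennreal (sqnorm M (\<lambda>x. s i x - g x)) \<le> ennreal e"
      using le int by (subst (asm) nn_integral_eq_integral) auto
    ultimately show ?thesis
      using e by (auto simp: L2_fun_def)
  qed
  show ?thesis
  proof
    obtain N where "\<And>i j. i \<ge> N \<Longrightarrow> j \<ge> N \<Longrightarrow> sqnorm M (\<lambda>x. s i x - s j x) < 1"
      using cauchy[of 1] by auto
    then have "(\<lambda>x. s N x - g x) \<in> L2_fun M"
      using close[of 1 N N] by simp
    from L2_fun_diff[OF s[of N] this] show "g \<in> L2_fun M"
      by simp
    show "(\<lambda>i. sqnorm M (\<lambda>x. s i x - g x)) \<longlonglongrightarrow> 0"
    proof (rule LIMSEQ_I)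
      fix e :: real assume "e > 0"
      then obtain N where N: "\<And>i j. i \<ge> N \<Longrightarrow> j \<ge> N \<Longrightarrow> sqnorm M (\<lambda>x. s i x - s j x) < e / 2"
        using cauchy[of "e / 2"] by auto
      have "norm (sqnorm M (\<lambda>x. s i x - g x) - 0) < e" if "i \<ge> N" for i
        using close[of "e / 2" N i] N \<open>e > 0\<close> that by (simp add: abs_of_nonneg)
      then show "\<exists>N. \<forall>i\<ge>N. norm (sqnorm M (\<lambda>x. s i x - g x) - 0) < e"
        by blast
    qed
  qed
qed

end

lemma cmod_parallelogram:
  "(cmod (a - b))\<^sup>2 = 2 * (cmod (f - a))\<^sup>2 + 2 * (cmod (f - b))\<^sup>2 - 4 * (cmod (f - (1/2) * (a + b)))\<^sup>2"
  unfolding cmod_power2 by (simp add: power2_eq_square field_simps)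

lemma sqnorm_diff_scale:
  assumes u: "u \<in> L2_fun M" and h: "h \<in> L2_fun M"
  shows "sqnorm M (\<lambda>x. u x - c * h x) =
    sqnorm M u - 2 * Re (cnj c * (\<integral>x. u x * cnj (h x) \<partial>M)) + (cmod c)\<^sup>2 * sqnorm M h"
proof -
  define R where "R x = Re (cnj c * (u x * cnj (h x)))" for x
  have R: "integrable M R"
    unfolding R_def using L2_fun_integrable_mult[OF u h] by (intro integrable_Re integrable_mult_right) auto
  have "sqnorm M (\<lambda>x. u x - c * h x) =
      (\<integral>x. (cmod (u x))\<^sup>2 - 2 * R x + (cmod c)\<^sup>2 * (cmod (h x))\<^sup>2 \<partial>M)"
    unfolding R_def cmod_power2
    by (intro Bochner_Integration.integral_cong refl) (simp add: power2_eq_square algebra_simps)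
  also have "\<dots> = sqnorm M u - 2 * (\<integral>x. R x \<partial>M) + (cmod c)\<^sup>2 * sqnorm M h"
    using R L2_fun_integrable[OF u] L2_fun_integrable[OF h] by simp
  also have "(\<integral>x. R x \<partial>M) = (\<integral>x. Re (cnj c * (u x * cnj (h x))) \<partial>M)"
    by (simp only: R_def)
  also have "(\<integral>x. Re (cnj c * (u x * cnj (h x))) \<partial>M) = Re (\<integral>x. cnj c * (u x * cnj (h x)) \<partial>M)"
    using L2_fun_integrable_mult[OF u h] by (intro integral_Re integrable_mult_right) auto
  also have "(\<integral>x. cnj c * (u x * cnj (h x)) \<partial>M) = cnj c * (\<integral>x. u x * cnj (h x) \<partial>M)"
    by simp
  finally show ?thesis .
qed

text \<open>By the parallelogram law a minimising sequence is a Cauchy sequence, since the midpoint of two of its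
  members is no closer to \<open>f\<close> than the infimum.\<close>

lemma (in finite_measure) nearest_point:
  assumes S: "closed_subspace M S" and f: "f \<in> L2_fun M"
  obtains g where "g \<in> L2_fun M" "L2_class M g \<in> S"
    "\<And>h. h \<in> L2_fun M \<Longrightarrow> L2_class M h \<in> S \<Longrightarrow> sqnorm M (\<lambda>x. f x - g x) \<le> sqnorm M (\<lambda>x. f x - h x)"
proof -
  define D where "D = {sqnorm M (\<lambda>x. f x - g x) | g. g \<in> L2_fun M \<and> L2_class M g \<in> S}"
  define d where "d = Inf D"
  have "D \<noteq> {}"
    using closed_subspaceD(2)[OF S] L2_fun_zero unfolding D_def L2_zero_def by blast
  have bdd: "bdd_below D"
    unfolding D_def by (rule bdd_belowI[of _ 0]) auto
  have d_le: "d \<le> sqnorm M (\<lambda>x. f x - h x)" if "h \<in> L2_fun M" "L2_class M h \<in> S" for h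
    unfolding d_def using that by (intro cInf_lower bdd) (auto simp: D_def)
  have d0: "d \<ge> 0"
    unfolding d_def using \<open>D \<noteq> {}\<close> by (intro cInf_greatest) (auto simp: D_def)
  have "\<exists>g. g \<in> L2_fun M \<and> L2_class M g \<in> S \<and> sqnorm M (\<lambda>x. f x - g x) < d + 1 / real (Suc k)" for k
    using cInf_lessD[OF \<open>D \<noteq> {}\<close>, of "d + 1 / real (Suc k)"] by (auto simp: D_def d_def)
  then obtain s where s: "\<And>k. s k \<in> L2_fun M" "\<And>k. L2_class M (s k) \<in> S"
      "\<And>k. sqnorm M (\<lambda>x. f x - s k x) < d + 1 / real (Suc k)"
    by metis
  have par: "sqnorm M (\<lambda>x. s i x - s j x) < 2 / real (Suc i) + 2 / real (Suc j)" for i j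
  proof -
    let ?m = "\<lambda>x. (1/2) * (s i x + s j x)"
    have m: "?m \<in> L2_fun M" "L2_class M ?m \<in> S"
    proof -
      show "?m \<in> L2_fun M"
        by (intro L2_fun_scale L2_fun_add s)
      have "L2_scale M (1/2) (L2_add M (L2_class M (s i)) (L2_class M (s j))) \<in> S"
        by (intro closed_subspaceD(3,4)[OF S] s)
      then show "L2_class M ?m \<in> S"
        using s by (simp add: L2_add_class L2_scale_class)
    qed
    have "sqnorm M (\<lambda>x. s i x - s j x) = (\<integral>x. 2 * (cmod (f x - s i x))\<^sup>2 + 2 * (cmod (f x - s j x))\<^sup>2 - 4 * (cmod (f x - ?m x))\<^sup>2 \<partial>M)"
      by (rule Bochner_Integration.integral_cong[OF refl]) (rule cmod_parallelogram)
    also have "\<dots> = 2 * sqnorm M (\<lambda>x. f x - s i x) + 2 * sqnorm M (\<lambda>x. f x - s j x) - 4 * sqnorm M (\<lambda>x. f x - ?m x)"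
      using L2_fun_integrable[OF L2_fun_diff[OF f s(1)[of i]]] L2_fun_integrable[OF L2_fun_diff[OF f s(1)[of j]]]
        L2_fun_integrable[OF L2_fun_diff[OF f m(1)]]
      by simp
    also have "\<dots> < 2 / real (Suc i) + 2 / real (Suc j)"
      using s(3)[of i] s(3)[of j] d_le[OF m] by simp
    finally show ?thesis .
  qed
  have "\<exists>N. \<forall>i\<ge>N. \<forall>j\<ge>N. sqnorm M (\<lambda>x. s i x - s j x) < e" if "e > 0" for e
  proof -
    obtain N where N: "1 / real (Suc N) < e / 4"
      using reals_Archimedean[of "e / 4"] \<open>e > 0\<close> by (auto simp: inverse_eq_divide)
    have "sqnorm M (\<lambda>x. s i x - s j x) < e" if "i \<ge> N" "j \<ge> N" for i j
    proof -
      have "1 / real (Suc i) \<le> 1 / real (Suc N)" "1 / real (Suc j) \<le> 1 / real (Suc N)"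
        using that by (auto simp: frac_le)
      then show ?thesis
        using par[of i j] N by simp
    qed
    then show ?thesis by blast
  qed
  then obtain g where g: "g \<in> L2_fun M" and lim: "(\<lambda>i. sqnorm M (\<lambda>x. s i x - g x)) \<longlonglongrightarrow> 0"
    using L2_complete[of s] s(1) by blast
  have "L2_class M g \<in> L2_closure M S"
  proof (rule L2_closure_classI[OF g])
    fix e :: real assume "e > 0"
    then have "\<forall>\<^sub>F i in sequentially. sqnorm M (\<lambda>x. s i x - g x) < e"
      using order_tendstoD(2)[OF lim] by blast
    then obtain i where "sqnorm M (\<lambda>x. s i x - g x) < e"
      using eventually_happens by force
    then show "\<exists>h. h \<in> L2_fun M \<and> L2_class M h \<in> S \<and> sqnorm M (\<lambda>x. g x - h x) < e"
      using s by (intro exI[of _ "s i"]) (simp add: norm_minus_commute)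
  qed
  then have gS: "L2_class M g \<in> S"
    using closed_subspaceD(5)[OF S] by simp
  \<comment> \<open>The infimum is attained at the limit up to a factor \<open>1 + t\<close>, for every \<open>t > 0\<close>.\<close>
  have bound: "sqnorm M (\<lambda>x. f x - g x) \<le> (1 + t) * d" if "t > 0" for t
  proof (rule LIMSEQ_le_const)
    show "(\<lambda>i. (1 + t) * (d + 1 / real (Suc i)) + (1 + 1 / t) * sqnorm M (\<lambda>x. s i x - g x)) \<longlonglongrightarrow> (1 + t) * d"
      using tendsto_add[OF tendsto_mult_left[OF tendsto_add[OF tendsto_const LIMSEQ_inverse_real_of_nat], of "1 + t" d]
          tendsto_mult_left[OF lim, of "1 + 1 / t"]] by (simp add: inverse_eq_divide)
    have "sqnorm M (\<lambda>x. f x - g x) \<le> (1 + t) * (d + 1 / real (Suc i)) + (1 + 1 / t) * sqnorm M (\<lambda>x. s i x - g x)" for i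
    proof (rule order_trans[OF sqnorm_triangle_weighted[OF f s(1)[of i] g that]])
      show "(1 + t) * sqnorm M (\<lambda>x. f x - s i x) + (1 + 1 / t) * sqnorm M (\<lambda>x. s i x - g x)
          \<le> (1 + t) * (d + 1 / real (Suc i)) + (1 + 1 / t) * sqnorm M (\<lambda>x. s i x - g x)"
        using s(3)[of i] that by (intro add_right_mono mult_left_mono) auto
    qed
    then show "\<exists>N. \<forall>i\<ge>N. sqnorm M (\<lambda>x. f x - g x) \<le> (1 + t) * (d + 1 / real (Suc i)) + (1 + 1 / t) * sqnorm M (\<lambda>x. s i x - g x)"
      by blast
  qed
  have "sqnorm M (\<lambda>x. f x - g x) \<le> d"
  proof (rule field_le_epsilon)
    fix e :: real assume "e > 0"
    then have "sqnorm M (\<lambda>x. f x - g x) \<le> (1 + e / (d + 1)) * d"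
      using d0 by (intro bound) simp
    also have "\<dots> \<le> d + e"
      using d0 \<open>e > 0\<close> by (simp add: field_simps)
    finally show "sqnorm M (\<lambda>x. f x - g x) \<le> d + e" .
  qed
  then show ?thesis
    using that[OF g gS] d_le by force
qed

text \<open>If \<open>g\<close> is nearest to \<open>f\<close> then \<open>f - g\<close> is orthogonal to every \<open>h\<close> in the subspace, since otherwise
  moving \<open>g\<close> a little along \<open>h\<close> would decrease the distance.\<close>

lemma (in finite_measure) projection:
  assumes S: "closed_subspace M S" and F: "F \<in> L2 M"
  obtains Q where "Q \<in> S" "\<And>G. G \<in> S \<Longrightarrow> L2_inner M F G = L2_inner M Q G"
proof -
  obtain f where f: "f \<in> L2_fun M" "F = L2_class M f"
    using F by (auto elim: L2_cases)
  obtain g where g: "g \<in> L2_fun M" "L2_class M g \<in> S"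
    and min: "\<And>h. h \<in> L2_fun M \<Longrightarrow> L2_class M h \<in> S \<Longrightarrow> sqnorm M (\<lambda>x. f x - g x) \<le> sqnorm M (\<lambda>x. f x - h x)"
    using nearest_point[OF S f(1)] by blast
  have "L2_inner M F G = L2_inner M (L2_class M g) G" if "G \<in> S" for G
  proof -
    obtain h where h: "h \<in> L2_fun M" "G = L2_class M h"
      using \<open>G \<in> S\<close> closed_subspaceD(1)[OF S] by (auto elim: L2_cases)
    define p where "p = (\<integral>x. (f x - g x) * cnj (h x) \<partial>M)"
    define q where "q = sqnorm M h"
    have q: "q \<ge> 0"
      by (simp add: q_def)
    \<comment> \<open>Any multiple of \<open>p\<close> by a sufficiently small positive number would do; the summand \<open>1\<close> keeps the
      denominator positive when \<open>h = 0\<close>.\<close>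
    define c where "c = p / of_real (q + 1)"
    have gh: "(\<lambda>x. g x + c * h x) \<in> L2_fun M" "L2_class M (\<lambda>x. g x + c * h x) \<in> S"
    proof -
      show "(\<lambda>x. g x + c * h x) \<in> L2_fun M"
        using g h by simp
      have "L2_add M (L2_class M g) (L2_scale M c G) \<in> S"
        by (intro closed_subspaceD(3,4)[OF S] g \<open>G \<in> S\<close>)
      then show "L2_class M (\<lambda>x. g x + c * h x) \<in> S"
        using g h by (simp add: L2_add_class L2_scale_class)
    qed
    have pp: "cnj p * p = of_real ((cmod p)\<^sup>2)"
      by (metis complex_norm_square mult.commute)
    have "sqnorm M (\<lambda>x. f x - g x) \<le> sqnorm M (\<lambda>x. (f x - g x) - c * h x)"
      using min[OF gh] by (simp add: diff_diff_eq)
    also have "\<dots> = sqnorm M (\<lambda>x. f x - g x) - 2 * Re (cnj c * p) + (cmod c)\<^sup>2 * q"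
      using sqnorm_diff_scale[OF L2_fun_diff[OF f(1) g(1)] h(1), of c] by (simp add: p_def q_def)
    finally have "2 * Re (cnj c * p) \<le> (cmod c)\<^sup>2 * q"
      by simp
    also have "cnj c * p = of_real ((cmod p)\<^sup>2 / (q + 1))"
      by (simp add: c_def pp del: of_real_add of_real_power)
    also have "(cmod c)\<^sup>2 = (cmod p)\<^sup>2 / (q + 1)\<^sup>2"
      using q by (simp add: c_def norm_divide power_divide del: of_real_add)
    finally have "2 * ((cmod p)\<^sup>2 / (q + 1)) \<le> (cmod p)\<^sup>2 / (q + 1)\<^sup>2 * q"
      by simp
    moreover have "2 * (P / k) \<le> P / k\<^sup>2 * q \<Longrightarrow> 2 * P * k \<le> P * q" if "k > 0" for P k :: real
      using that by (simp add: field_simps power2_eq_square)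
    ultimately have "2 * (cmod p)\<^sup>2 * (q + 1) \<le> (cmod p)\<^sup>2 * q"
      using q by simp
    then have "(cmod p)\<^sup>2 * (q + 2) \<le> 0"
      by (simp add: algebra_simps)
    moreover have "(cmod p)\<^sup>2 * (q + 2) \<ge> 0"
      using q by simp
    ultimately have "p = 0"
      using q by (smt (verit) mult_eq_0_iff norm_eq_zero power_eq_0_iff)
    moreover have "p = L2_inner M F G - L2_inner M (L2_class M g) G"
      using f g h by (simp add: p_def L2_inner_class left_diff_distrib)
    ultimately show ?thesis by simp
  qed
  with g(2) show ?thesis
    using that by blast
qed

section \<open>Arc length on the boundary circles\<close>

lemma integral_cis_period:
  "(\<integral>t. indicator {0..<2 * pi} t *\<^sub>R cis (of_int k * t) \<partial>lborel) = (if k = 0 then 2 * pi else 0)"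
proof -
  have "(\<integral>t. indicator {0..<2 * pi} t *\<^sub>R cis (of_int k * t) \<partial>lborel)
      = (\<integral>t. indicator {0..2 * pi} t *\<^sub>R cis (of_int k * t) \<partial>lborel)"
  proof (rule integral_cong_AE)
    have [measurable]: "(\<lambda>t. cis (of_int k * t)) \<in> borel_measurable borel"
      by (intro borel_measurable_continuous_onI continuous_intros)
    show "(\<lambda>t. indicator {0..<2 * pi} t *\<^sub>R cis (of_int k * t)) \<in> borel_measurable lborel"
      "(\<lambda>t. indicator {0..2 * pi} t *\<^sub>R cis (of_int k * t)) \<in> borel_measurable lborel"
      by measurable
    show "AE t in lborel. indicator {0..<2 * pi} t *\<^sub>R cis (of_int k * t) =
        indicator {0..2 * pi} t *\<^sub>R cis (of_int k * t)"
      using AE_lborel_singleton[of "2 * pi"] by eventually_elim (auto simp: indicator_def)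
  qed
  also have "\<dots> = (if k = 0 then 2 * pi else 0)"
  proof (cases "k = 0")
    case False
    let ?F = "\<lambda>z. exp (\<i> * of_int k * z) / (\<i> * of_int k)"
    have "(\<integral>t. indicator {0..2 * pi} t *\<^sub>R cis (of_int k * t) \<partial>lborel) = ?F (of_real (2 * pi)) - ?F (of_real 0)"
    proof (rule integral_FTC_Icc)
      fix t :: real
      have "(?F has_field_derivative exp (\<i> * of_int k * of_real t)) (at (of_real t))"
        using False by (auto intro!: derivative_eq_intros)
      from has_vector_derivative_real_field[OF this]
      show "((\<lambda>t. ?F (of_real t)) has_vector_derivative cis (of_int k * t)) (at t within {0..2 * pi})"
        by (simp add: cis_conv_exp mult.assoc)
    qed (auto intro!: continuous_intros)
    also have "\<dots> = 0"
    proof -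
      have "exp (\<i> * of_int k * of_real (2 * pi)) = cis (2 * pi * of_int k)"
        by (simp add: cis_conv_exp mult_ac)
      also have "\<dots> = 1"
        by (rule cis_multiple_2pi) auto
      finally show ?thesis by simp
    qed
    finally show ?thesis
      using False by simp
  qed (simp add: scaleR_conv_of_real)
  finally show ?thesis .
qed

lemma integral_circle_measure:
  fixes f :: "complex \<Rightarrow> complex"
  assumes [measurable]: "f \<in> borel_measurable borel" and "\<rho> \<ge> 0"
  shows "(\<integral>z. f z \<partial>circle_measure \<rho>) =
    \<rho> * (\<integral>t. indicator {0..<2 * pi} t *\<^sub>R f (of_real \<rho> * cis t) \<partial>lborel)"
proof -
  let ?N = "distr (restrict_space lborel {0..<2 * pi}) borel (\<lambda>t. of_real \<rho> * cis t)"
  have [measurable]: "(\<lambda>t. of_real \<rho> * cis t) \<in> borel_measurable (restrict_space lborel {0..<2 * pi})"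
    by (intro measurable_restrict_space1) (simp add: borel_measurable_continuous_onI continuous_intros)
  have "circle_measure \<rho> = density ?N (\<lambda>_. ennreal \<rho>)"
    unfolding circle_measure_def by (rule measure_eqI) (simp_all add: emeasure_density_const)
  then have "(\<integral>z. f z \<partial>circle_measure \<rho>) = (\<integral>z. \<rho> *\<^sub>R f z \<partial>?N)"
    using assms by (simp add: integral_density)
  also have "\<dots> = (\<integral>t. \<rho> *\<^sub>R f (of_real \<rho> * cis t) \<partial>restrict_space lborel {0..<2 * pi})"
    by (rule integral_distr) measurable
  also have "\<dots> = \<rho> *\<^sub>R (\<integral>t. indicator {0..<2 * pi} t *\<^sub>R f (of_real \<rho> * cis t) \<partial>lborel)"
    by (simp add: integral_restrict_space)
  finally show ?thesis
    by (simp add: scaleR_conv_of_real)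
qed

lemma emeasure_circle_measure_Int:
  assumes "E \<in> sets borel" "\<rho> \<ge> 0"
  shows "emeasure (circle_measure \<rho>) (E \<inter> sphere 0 \<rho>) = emeasure (circle_measure \<rho>) E"
  using assms by (auto simp: emeasure_circle_measure norm_mult intro!: arg_cong2[of _ _ _ _ "(*)"] arg_cong[of _ _ "emeasure lborel"])

lemma emeasure_circle_measure_disjoint:
  assumes "E \<in> sets borel" "\<rho> \<ge> 0" "E \<inter> sphere 0 \<rho> = {}"
  shows "emeasure (circle_measure \<rho>) E = 0"
  using emeasure_circle_measure_Int[OF assms(1,2)] assms(3) by simp

lemma measurable_power_int [measurable]: "(\<lambda>z::complex. z powi m) \<in> borel_measurable borel"
  unfolding power_int_def by measurable

locale hardy_annulus =
  fixes r :: real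
  assumes r_pos: "0 < r" and r_less_1: "r < 1"
begin

abbreviation M where "M \<equiv> boundary_measure r"

lemma measurable_boundary_eq [simp]: "borel_measurable M = borel_measurable borel"
  by (rule measurable_cong_sets) simp_all

sublocale finite_measure M
proof
  have "emeasure (circle_measure \<rho>) UNIV \<noteq> \<infinity>" if "\<rho> \<ge> 0" for \<rho>
  proof -
    have "{t. 0 \<le> t \<and> t < 2 * pi} = {0..<2 * pi}" by auto
    then show ?thesis
      by (simp add: emeasure_circle_measure ennreal_mult_eq_top_iff)
  qed
  then show "emeasure M (space M) \<noteq> \<infinity>"
    using r_pos by (simp add: emeasure_boundary_measure)
qed

lemma AE_boundary: "AE z in M. cmod z = 1 \<or> cmod z = r"
proof (rule AE_I')
  let ?N = "- (sphere 0 1 \<union> sphere 0 r) :: complex set"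
  have N: "?N \<in> sets borel"
    by measurable
  show "?N \<in> null_sets M"
    using N r_pos by (intro null_setsI)
      (auto simp: emeasure_boundary_measure emeasure_circle_measure_disjoint disjoint_iff)
qed auto

lemma AE_boundary_nonzero: "AE z in M. z \<noteq> 0"
  using AE_boundary by eventually_elim (use r_pos in auto)

text \<open>The two circles are disjoint, so arc length on one of them is the restriction of the boundary measure to
  it. Seen in this way, integrals over the boundary split by the theorems on densities.\<close>

lemma circle_measure_eq_density:
  assumes "\<rho> = 1 \<or> \<rho> = r"
  shows "circle_measure \<rho> = density M (\<lambda>z. ennreal (indicator (sphere 0 \<rho>) z))"
proof (rule measure_eqI)
  fix E assume "E \<in> sets (circle_measure \<rho>)"
  then have E: "E \<in> sets borel" by simp
  have S: "sphere 0 \<rho> \<in> sets (borel :: complex measure)" by measurable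
  have "emeasure (density M (\<lambda>z. ennreal (indicator (sphere 0 \<rho>) z))) E =
      (\<integral>\<^sup>+z. indicator (E \<inter> sphere 0 \<rho>) z \<partial>M)"
  proof (subst emeasure_density)
    show "(\<integral>\<^sup>+z. ennreal (indicator (sphere 0 \<rho>) z) * indicator E z \<partial>M) = (\<integral>\<^sup>+z. indicator (E \<inter> sphere 0 \<rho>) z \<partial>M)"
      by (rule nn_integral_cong) (simp split: split_indicator)
  qed (use E borel_measurable_indicator[OF S] in simp_all)
  also have "\<dots> = emeasure M (E \<inter> sphere 0 \<rho>)"
    using E S by (intro nn_integral_indicator) auto
  also have "\<dots> = emeasure (circle_measure 1) (E \<inter> sphere 0 \<rho>) + emeasure (circle_measure r) (E \<inter> sphere 0 \<rho>)"
    using E S by (intro emeasure_boundary_measure) auto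
  also have "\<dots> = emeasure (circle_measure \<rho>) E"
  proof (cases "\<rho> = 1")
    case True
    have "emeasure (circle_measure r) (E \<inter> sphere 0 1) = 0"
      using E r_pos r_less_1 by (intro emeasure_circle_measure_disjoint) auto
    with True E show ?thesis
      by (simp add: emeasure_circle_measure_Int)
  next
    case False
    have "emeasure (circle_measure 1) (E \<inter> sphere 0 r) = 0"
      using E r_pos r_less_1 by (intro emeasure_circle_measure_disjoint) auto
    with False assms r_pos E show ?thesis
      by (simp add: emeasure_circle_measure_Int)
  qed
  finally show "emeasure (circle_measure \<rho>) E = emeasure (density M (\<lambda>z. ennreal (indicator (sphere 0 \<rho>) z))) E" ..
qed simp

lemma integral_boundary:
  fixes f :: "complex \<Rightarrow> complex"
  assumes f: "integrable M f"
  shows "(\<integral>z. f z \<partial>M) = (\<integral>z. f z \<partial>circle_measure 1) + (\<integral>z. f z \<partial>circle_measure r)"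
proof -
  have [measurable]: "f \<in> borel_measurable borel"
    using borel_measurable_integrable[OF f] by simp
  have S [measurable]: "sphere 0 \<rho> \<in> sets (borel :: complex measure)" for \<rho> by measurable
  have int: "integrable M (\<lambda>z. indicator (sphere 0 \<rho>) z *\<^sub>R f z)" for \<rho>
    using f by (intro integrable_mult_indicator) auto
  have "(\<integral>z. f z \<partial>M) = (\<integral>z. indicator (sphere 0 1) z *\<^sub>R f z + indicator (sphere 0 r) z *\<^sub>R f z \<partial>M)"
  proof (rule integral_cong_AE)
    show "AE z in M. f z = indicator (sphere 0 1) z *\<^sub>R f z + indicator (sphere 0 r) z *\<^sub>R f z"
      using AE_boundary by eventually_elim (use r_less_1 in \<open>auto simp: indicator_def\<close>)
  qed simp_all
  also have "\<dots> = (\<integral>z. indicator (sphere 0 1) z *\<^sub>R f z \<partial>M) + (\<integral>z. indicator (sphere 0 r) z *\<^sub>R f z \<partial>M)"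
    by (intro Bochner_Integration.integral_add int)
  also have "\<dots> = (\<integral>z. f z \<partial>circle_measure 1) + (\<integral>z. f z \<partial>circle_measure r)"
    by (simp add: circle_measure_eq_density integral_density)
  finally show ?thesis .
qed

lemma L2_fun_bounded:
  assumes "f \<in> borel_measurable borel" and B: "\<And>z. r \<le> cmod z \<Longrightarrow> cmod z \<le> 1 \<Longrightarrow> cmod (f z) \<le> B"
  shows "f \<in> L2_fun M"
proof (rule L2_funI_bound)
  show "integrable M (\<lambda>_. B\<^sup>2)" by simp
  show "AE z in M. (cmod (f z))\<^sup>2 \<le> B\<^sup>2"
    using AE_boundary by eventually_elim (use r_less_1 in \<open>auto intro!: power_mono B\<close>)
qed (use assms in simp)

lemma sqnorm_le_bounded:
  assumes "f \<in> L2_fun M" and B: "\<And>z. r \<le> cmod z \<Longrightarrow> cmod z \<le> 1 \<Longrightarrow> cmod (f z) \<le> B"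
  shows "sqnorm M f \<le> B\<^sup>2 * measure M UNIV"
proof -
  have "sqnorm M f \<le> (\<integral>z. B\<^sup>2 \<partial>M)"
  proof (rule integral_mono_AE)
    show "AE z in M. (cmod (f z))\<^sup>2 \<le> B\<^sup>2"
      using AE_boundary by eventually_elim (use r_less_1 in \<open>auto intro!: power_mono B\<close>)
  qed (use L2_fun_integrable[OF assms(1)] in simp_all)
  then show ?thesis by (simp add: mult.commute)
qed

abbreviation closed_annulus where "closed_annulus \<equiv> {z. r \<le> cmod z \<and> cmod z \<le> 1}"

lemma compact_closed_annulus: "compact closed_annulus"
proof -
  have "closed_annulus = cball 0 1 - ball 0 r" by auto
  then show ?thesis by (simp add: compact_diff)
qed

lemma bounded_on_closed_annulus:
  fixes f :: "complex \<Rightarrow> complex"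
  assumes "continuous_on closed_annulus f"
  shows "\<exists>B. \<forall>z\<in>closed_annulus. cmod (f z) \<le> B"
  using compact_imp_bounded[OF compact_continuous_image[OF assms compact_closed_annulus]]
  by (auto simp: bounded_iff)

lemma L2_fun_continuous:
  assumes "f \<in> borel_measurable borel" "continuous_on closed_annulus f"
  shows "f \<in> L2_fun M"
  using L2_fun_bounded[OF assms(1)] bounded_on_closed_annulus[OF assms(2)] by blast

subsection \<open>Orthogonality of the monomials\<close>

lemma L2_fun_monomial [simp]: "(\<lambda>z. z powi m) \<in> L2_fun M"
  by (rule L2_fun_continuous) (use r_pos in \<open>auto intro!: continuous_intros\<close>)

definition zpow :: "int \<Rightarrow> (complex \<Rightarrow> complex) set" where
  "zpow m = L2_class M (\<lambda>z. z powi m)"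

lemma zpow_in_L2 [simp]: "zpow m \<in> L2 M"
  by (simp add: zpow_def)

text \<open>The squared norm of \<open>z\<^sup>m\<close>.\<close>

definition weight :: "int \<Rightarrow> real" where
  "weight m = 2 * pi * (1 + r powi (2 * m + 1))"

lemma weight_pos: "weight m > 0"
  unfolding weight_def using r_pos by (simp add: add_pos_pos)

text \<open>On the circle of radius \<open>\<rho>\<close> the integrand is \<open>\<rho>\<^bsup>i+j\<^esup>\<close> times \<open>cis ((i - j) t)\<close>, and arc length
  contributes one more factor \<open>\<rho>\<close>; this is where the odd exponent \<open>2i + 1\<close> in the weight comes from.\<close>

lemma inner_zpow: "L2_inner M (zpow i) (zpow j) = (if i = j then of_real (weight i) else 0)"
proof -
  have circle: "(\<integral>z. z powi i * cnj (z powi j) \<partial>circle_measure \<rho>) =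
      (if i = j then of_real (2 * pi * \<rho> powi (2 * i + 1)) else 0)" if "\<rho> > 0" for \<rho>
  proof -
    have eq: "(of_real \<rho> * cis t) powi i * cnj ((of_real \<rho> * cis t) powi j) =
        of_real (\<rho> powi (i + j)) * cis (of_int (i - j) * t)" for t
    proof -
      have "cnj ((of_real \<rho> * cis t) powi j) = of_real (\<rho> powi j) * cis (- (of_int j * t))"
        by (simp add: power_int_mult_distrib cis_power_int cis_cnj)
      then show ?thesis
        using that by (simp add: power_int_mult_distrib cis_power_int power_int_add cis_mult algebra_simps)
    qed
    have "(\<integral>z. z powi i * cnj (z powi j) \<partial>circle_measure \<rho>) =
        \<rho> * (\<integral>t. indicator {0..<2 * pi} t *\<^sub>R (of_real (\<rho> powi (i + j)) * cis (of_int (i - j) * t)) \<partial>lborel)"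
      using that unfolding eq[symmetric] by (intro integral_circle_measure) auto
    also have "\<dots> = \<rho> * (of_real (\<rho> powi (i + j)) * (\<integral>t. indicator {0..<2 * pi} t *\<^sub>R cis (of_int (i - j) * t) \<partial>lborel))"
      by (subst integral_mult_right_zero[symmetric]) (simp only: mult_scaleR_right)
    also have "\<dots> = (if i = j then of_real (2 * pi * \<rho> powi (2 * i + 1)) else 0)"
    proof -
      have "\<rho> powi (2 * i + 1) = \<rho> * \<rho> powi (i + i)"
        using power_int_add[of \<rho> 1 "i + i"] that by (simp add: add.commute)
      then show ?thesis
        unfolding integral_cis_period by (cases "i = j") simp_all
    qed
    finally show ?thesis .
  qed
  have "L2_inner M (zpow i) (zpow j) = (\<integral>z. z powi i * cnj (z powi j) \<partial>M)"
    unfolding zpow_def by (rule L2_inner_class) simp_all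
  also have "\<dots> = (\<integral>z. z powi i * cnj (z powi j) \<partial>circle_measure 1) + (\<integral>z. z powi i * cnj (z powi j) \<partial>circle_measure r)"
    by (intro integral_boundary L2_fun_integrable_mult L2_fun_monomial)
  also have "\<dots> = (if i = j then of_real (weight i) else 0)"
    using circle[of 1] circle[of r] r_pos by (simp add: weight_def algebra_simps)
  finally show ?thesis .
qed

end

section \<open>The Hardy space is the closed span of the monomials\<close>

text \<open>Uniform approximability by Laurent polynomials. Writing these as \<open>p(z) / z\<^sup>k\<close> with a
  polynomial \<open>p\<close> makes their sums and products immediate.\<close>

definition laurent_approximable :: "complex set \<Rightarrow> (complex \<Rightarrow> complex) \<Rightarrow> bool" where
  "laurent_approximable K f \<longleftrightarrow> (\<forall>e>0. \<exists>p k. \<forall>z\<in>K. cmod (f z - poly p z / z ^ k) \<le> e)"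

lemma laurent_approximable_poly: "laurent_approximable K (poly p)"
  unfolding laurent_approximable_def
proof (intro allI impI exI ballI)
  fix e :: real and z assume "e > 0"
  then show "cmod (poly p z - poly p z / z ^ 0) \<le> e" by simp
qed

lemma laurent_approximable_mult:
  assumes f: "laurent_approximable K f" "\<And>z. z \<in> K \<Longrightarrow> cmod (f z) \<le> A"
    and g: "laurent_approximable K g" "\<And>z. z \<in> K \<Longrightarrow> cmod (g z) \<le> B"
  shows "laurent_approximable K (\<lambda>z. f z * g z)"
  unfolding laurent_approximable_def
proof (intro allI impI)
  fix e :: real assume e: "e > 0"
  define C where "C = \<bar>A\<bar> + \<bar>B\<bar> + 1"
  define d where "d = min 1 (e / C)"
  have C: "C > 0" by (simp add: C_def)
  have d: "d > 0" "d \<le> 1" "d * C \<le> e"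
    using e C by (auto simp: d_def min_def field_simps)
  obtain p k where p: "\<And>z. z \<in> K \<Longrightarrow> cmod (f z - poly p z / z ^ k) \<le> d"
    using f(1) d(1) unfolding laurent_approximable_def by blast
  obtain q l where q: "\<And>z. z \<in> K \<Longrightarrow> cmod (g z - poly q z / z ^ l) \<le> d"
    using g(1) d(1) unfolding laurent_approximable_def by blast
  show "\<exists>p k. \<forall>z\<in>K. cmod (f z * g z - poly p z / z ^ k) \<le> e"
  proof (intro exI ballI)
    fix z assume z: "z \<in> K"
    define a b where "a = poly p z / z ^ k" and "b = poly q z / z ^ l"
    have "cmod b \<le> cmod (g z) + cmod (g z - b)"
      by (metis norm_minus_commute norm_triangle_sub)
    then have b: "cmod b \<le> \<bar>B\<bar> + 1"
      using g(2)[OF z] q[OF z] d(2) by (auto simp: b_def)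
    have "f z * g z - poly (p * q) z / z ^ (k + l) = f z * (g z - b) + (f z - a) * b"
      by (simp add: a_def b_def power_add algebra_simps)
    also have "cmod \<dots> \<le> cmod (f z) * cmod (g z - b) + cmod (f z - a) * cmod b"
      by (metis norm_mult norm_triangle_ineq)
    also have "\<dots> \<le> \<bar>A\<bar> * d + d * (\<bar>B\<bar> + 1)"
      using f(2)[OF z] p[OF z] q[OF z] b d(1)
      by (intro add_mono mult_mono) (auto simp: a_def b_def)
    also have "\<dots> \<le> e"
      using d(3) by (simp add: C_def algebra_simps)
    finally show "cmod (f z * g z - poly (p * q) z / z ^ (k + l)) \<le> e" .
  qed
qed

lemma laurent_approximableI_geometric:
  assumes q: "0 \<le> q" "q < 1" and d: "d > 0"
    and "\<And>N. \<exists>p k. \<forall>z\<in>K. cmod (f z - poly p z / z ^ k) \<le> q ^ N / d"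
  shows "laurent_approximable K f"
  unfolding laurent_approximable_def
proof (intro allI impI)
  fix e :: real assume "e > 0"
  then obtain N where "q ^ N < e * d"
    using real_arch_pow_inv[of "e * d" q] q d by auto
  then have "q ^ N / d \<le> e"
    using d by (simp add: field_simps)
  then show "\<exists>p k. \<forall>z\<in>K. cmod (f z - poly p z / z ^ k) \<le> e"
    using assms(4)[of N] by (meson order_trans)
qed

text \<open>For \<open>|a| < r \<le> |z|\<close> the truncated expansion of \<open>1 / (z - a)\<close> in powers of \<open>a / z\<close> has the
  remainder \<open>(a / z)\<^sup>N / (z - a)\<close>.\<close>

lemma laurent_approximable_inverse_linear_inside:
  assumes a: "cmod a < r" and K: "\<And>z. z \<in> K \<Longrightarrow> r \<le> cmod z"
  shows "laurent_approximable K (\<lambda>z. 1 / (z - a))"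
proof (rule laurent_approximableI_geometric)
  have r: "r > 0" using a norm_ge_zero[of a] by linarith
  show "0 \<le> cmod a / r" "cmod a / r < 1" "r - cmod a > 0"
    using a r by auto
  fix N
  let ?p = "\<Sum>k<N. monom (a ^ k) (N - 1 - k)"
  show "\<exists>p k. \<forall>z\<in>K. cmod (1 / (z - a) - poly p z / z ^ k) \<le> (cmod a / r) ^ N / (r - cmod a)"
  proof (intro exI ballI)
    fix z assume "z \<in> K"
    then have z: "r \<le> cmod z" by (rule K)
    then have nz: "z \<noteq> 0" "z \<noteq> a" using r a by auto
    have "poly ?p z = (\<Sum>k<N. z ^ (N - Suc k) * a ^ k)"
      by (simp add: poly_sum poly_monom mult.commute)
    then have "a ^ N - z ^ N = (a - z) * poly ?p z"
      using power_diff_sumr2[of a N z] by simp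
    then have "z ^ N - a ^ N = (z - a) * poly ?p z"
      by (metis minus_diff_eq mult_minus_left)
    then have "1 / (z - a) - poly ?p z / z ^ N = (a / z) ^ N / (z - a)"
      using nz by (simp add: field_simps)
    moreover have "cmod ((a / z) ^ N / (z - a)) \<le> (cmod a / r) ^ N / (r - cmod a)"
      unfolding norm_divide norm_power
    proof (rule frac_le)
      show "(cmod a / cmod z) ^ N \<le> (cmod a / r) ^ N"
        using z r nz by (intro power_mono divide_left_mono mult_pos_pos) auto
      show "r - cmod a \<le> cmod (z - a)"
        using z norm_triangle_ineq2[of z a] by linarith
    qed (use a r in auto)
    ultimately show "cmod (1 / (z - a) - poly ?p z / z ^ N) \<le> (cmod a / r) ^ N / (r - cmod a)"
      by simp
  qed
qed

text \<open>For \<open>|z| \<le> 1 < |a|\<close> one expands in powers of \<open>z / a\<close> instead; the remainder is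
  \<open>(z / a)\<^sup>N / (z - a)\<close>.\<close>

lemma laurent_approximable_inverse_linear_outside:
  assumes a: "1 < cmod a" and K: "\<And>z. z \<in> K \<Longrightarrow> cmod z \<le> 1"
  shows "laurent_approximable K (\<lambda>z. 1 / (z - a))"
proof (rule laurent_approximableI_geometric)
  have "cmod a > 0" using a by linarith
  then show "0 \<le> 1 / cmod a" "1 / cmod a < 1" "cmod a - 1 > 0"
    using a by (simp_all add: divide_less_eq)
  fix N
  let ?p = "smult (- 1 / a ^ N) (\<Sum>k<N. monom (a ^ (N - Suc k)) k)"
  show "\<exists>p k. \<forall>z\<in>K. cmod (1 / (z - a) - poly p z / z ^ k) \<le> (1 / cmod a) ^ N / (cmod a - 1)"
  proof (intro exI ballI)
    fix z assume "z \<in> K"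
    then have z: "cmod z \<le> 1" by (rule K)
    have nz: "a \<noteq> 0" "z \<noteq> a" using a z by auto
    define s where "s = (\<Sum>k<N. a ^ (N - Suc k) * z ^ k)"
    have "z ^ N = a ^ N + (z - a) * s"
      using power_diff_sumr2[of z N a] by (simp add: s_def diff_eq_eq add.commute)
    moreover have "poly ?p z = - s / a ^ N"
      by (simp add: poly_sum poly_monom s_def)
    ultimately have "1 / (z - a) - poly ?p z / z ^ 0 = (z / a) ^ N / (z - a)"
      using nz by (simp add: field_simps)
    moreover have "cmod ((z / a) ^ N / (z - a)) \<le> (1 / cmod a) ^ N / (cmod a - 1)"
      unfolding norm_divide norm_power
    proof (rule frac_le)
      show "(cmod z / cmod a) ^ N \<le> (1 / cmod a) ^ N"
        using z a by (intro power_mono divide_right_mono) auto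
      show "cmod a - 1 \<le> cmod (z - a)"
        using z norm_triangle_ineq2[of a z] by (simp add: norm_minus_commute)
    qed (use a in auto)
    ultimately show "cmod (1 / (z - a) - poly ?p z / z ^ 0) \<le> (1 / cmod a) ^ N / (cmod a - 1)"
      by simp
  qed
qed

context hardy_annulus
begin

text \<open>Every point of the closed annulus is a limit of points of the open one on the same ray from the
  origin.\<close>

lemma closure_annulus: "closure (annulus r) = closed_annulus"
proof
  have "annulus r \<subseteq> cball 0 1 - ball 0 r"
    by (auto simp: annulus_def)
  then have "closure (annulus r) \<subseteq> cball 0 1 - ball 0 r"
    by (rule closure_minimal) (simp add: closed_Diff)
  then show "closure (annulus r) \<subseteq> closed_annulus" by auto
  show "closed_annulus \<subseteq> closure (annulus r)"
  proof
    fix z assume z: "z \<in> closed_annulus"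
    have "(\<lambda>s. of_real s * sgn z) ` closure {r<..<1} \<subseteq> closure (annulus r)"
    proof (rule image_closure_subset)
      show "(\<lambda>s. of_real s * sgn z) ` {r<..<1} \<subseteq> closure (annulus r)"
        using z r_pos by (intro order_trans[OF _ closure_subset]) (auto simp: annulus_def norm_mult norm_sgn)
    qed (auto intro!: continuous_intros)
    moreover have "cmod z \<in> closure {r<..<1}"
      using z r_less_1 by simp
    ultimately have "of_real (cmod z) * sgn z \<in> closure (annulus r)"
      by blast
    then show "z \<in> closure (annulus r)"
      using z r_pos by (simp add: sgn_eq)
  qed
qed

text \<open>All roots of \<open>q\<close> lie off the closed annulus, and linear factors can be inverted one at a time.\<close>

lemma laurent_approximable_inverse_poly:
  assumes "\<And>z. z \<in> closed_annulus \<Longrightarrow> poly q z \<noteq> 0"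
  shows "laurent_approximable closed_annulus (\<lambda>z. 1 / poly q z)"
  using assms
proof (induction "degree q" arbitrary: q)
  case 0
  then obtain c where "q = [:c:]"
    by (metis degree_eq_zeroE)
  then show ?case
    using laurent_approximable_poly[of closed_annulus "[:1 / c:]"] by (simp add: laurent_approximable_def)
next
  case (Suc n)
  then have "\<not> constant (poly q)"
    by (simp add: constant_degree)
  then obtain a where a: "poly q a = 0"
    using fundamental_theorem_of_algebra by blast
  then obtain q' where q': "q = [:- a, 1:] * q'"
    by (auto simp: poly_eq_0_iff_dvd)
  have "q' \<noteq> 0" using q' Suc(2) by auto
  then have deg: "degree q' = n"
    using Suc(2) unfolding q' by (subst (asm) degree_mult_eq) auto
  have nz: "z \<noteq> a" "poly q' z \<noteq> 0" if "z \<in> closed_annulus" for z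
    using Suc(3)[OF that] unfolding q' by auto
  have "a \<notin> closed_annulus"
    using Suc(3) a by auto
  then have lin: "laurent_approximable closed_annulus (\<lambda>z. 1 / (z - a))"
    using laurent_approximable_inverse_linear_inside[of a r closed_annulus]
      laurent_approximable_inverse_linear_outside[of a closed_annulus] by force
  have q'_approx: "laurent_approximable closed_annulus (\<lambda>z. 1 / poly q' z)"
    using Suc(1)[of q'] deg nz by blast
  have "continuous_on closed_annulus (\<lambda>z. 1 / (z - a))"
    using nz by (intro continuous_intros) auto
  then obtain A where A: "\<And>z. z \<in> closed_annulus \<Longrightarrow> cmod (1 / (z - a)) \<le> A"
    using bounded_on_closed_annulus by blast
  have "continuous_on closed_annulus (\<lambda>z. 1 / poly q' z)"
    using nz by (intro continuous_intros) auto
  then obtain B where B: "\<And>z. z \<in> closed_annulus \<Longrightarrow> cmod (1 / poly q' z) \<le> B"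
    using bounded_on_closed_annulus by blast
  have "laurent_approximable closed_annulus (\<lambda>z. 1 / (z - a) * (1 / poly q' z))"
    by (rule laurent_approximable_mult[OF lin A q'_approx B])
  moreover have "(\<lambda>z. 1 / poly q z) = (\<lambda>z. 1 / (z - a) * (1 / poly q' z))"
    unfolding q' by (auto simp: fun_eq_iff algebra_simps)
  ultimately show ?case by simp
qed

lemma rational_functionsE:
  assumes "f \<in> rational_functions r"
  obtains p q where "f = (\<lambda>z. poly p z / poly q z)" "\<And>z. z \<in> closed_annulus \<Longrightarrow> poly q z \<noteq> 0"
  using assms unfolding rational_functions_def closure_annulus by blast

lemma rational_functionsI:
  assumes "\<And>z. z \<in> closed_annulus \<Longrightarrow> poly q z \<noteq> 0"
  shows "(\<lambda>z. poly p z / poly q z) \<in> rational_functions r"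
  using assms unfolding rational_functions_def closure_annulus by blast

lemma laurent_approximable_rational:
  assumes "f \<in> rational_functions r"
  shows "laurent_approximable closed_annulus f"
proof -
  obtain p q where f: "f = (\<lambda>z. poly p z / poly q z)" and nz: "\<And>z. z \<in> closed_annulus \<Longrightarrow> poly q z \<noteq> 0"
    using rational_functionsE[OF assms] by blast
  obtain A where A: "\<And>z. z \<in> closed_annulus \<Longrightarrow> cmod (poly p z) \<le> A"
    using bounded_on_closed_annulus[OF continuous_on_poly[OF continuous_on_id]] by blast
  have "continuous_on closed_annulus (\<lambda>z. 1 / poly q z)"
    using nz by (intro continuous_intros) auto
  then obtain B where B: "\<And>z. z \<in> closed_annulus \<Longrightarrow> cmod (1 / poly q z) \<le> B"
    using bounded_on_closed_annulus by blast
  show ?thesis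
    using laurent_approximable_mult[OF laurent_approximable_poly A laurent_approximable_inverse_poly[OF nz] B]
    by (simp add: f)
qed

lemma measurable_poly [measurable]: "poly p \<in> borel_measurable (borel :: complex measure)"
  by (intro borel_measurable_continuous_onI continuous_intros)

lemma L2_fun_rational:
  assumes "f \<in> rational_functions r"
  shows "f \<in> L2_fun M"
proof -
  obtain p q where f: "f = (\<lambda>z. poly p z / poly q z)" and nz: "\<And>z. z \<in> closed_annulus \<Longrightarrow> poly q z \<noteq> 0"
    using rational_functionsE[OF assms] by blast
  show ?thesis
    unfolding f by (rule L2_fun_continuous) (use nz in \<open>auto intro!: continuous_intros\<close>)
qed

abbreviation H where "H \<equiv> hardy_space r"

lemma closed_subspace_hardy: "closed_subspace M H"
  unfolding hardy_space_def
proof (rule closed_subspace_closure)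
  let ?R = "L2_class M ` rational_functions r"
  show "?R \<subseteq> L2 M"
    using L2_fun_rational by auto
  have "(\<lambda>z. 0) \<in> rational_functions r"
    using rational_functionsI[of 1 0] by simp
  then show "L2_zero M \<in> ?R"
    by (auto simp: L2_zero_def)
  show "L2_scale M c F \<in> ?R" if F: "F \<in> ?R" for c F
  proof -
    obtain f where f: "f \<in> rational_functions r" "F = L2_class M f"
      using F by blast
    obtain p q where pq: "f = (\<lambda>z. poly p z / poly q z)" "\<And>z. z \<in> closed_annulus \<Longrightarrow> poly q z \<noteq> 0"
      using rational_functionsE[OF f(1)] by blast
    have "(\<lambda>z. c * f z) \<in> rational_functions r"
      using rational_functionsI[OF pq(2), of "smult c p"] by (simp add: pq(1))
    then show ?thesis
      using f L2_fun_rational by (auto simp: L2_scale_class)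
  qed
  show "L2_add M F G \<in> ?R" if FG: "F \<in> ?R" "G \<in> ?R" for F G
  proof -
    obtain f where f: "f \<in> rational_functions r" "F = L2_class M f"
      using FG by blast
    obtain g where g: "g \<in> rational_functions r" "G = L2_class M g"
      using FG by blast
    obtain p q where pq: "f = (\<lambda>z. poly p z / poly q z)" "\<And>z. z \<in> closed_annulus \<Longrightarrow> poly q z \<noteq> 0"
      using rational_functionsE[OF f(1)] by blast
    obtain p' q' where pq': "g = (\<lambda>z. poly p' z / poly q' z)" "\<And>z. z \<in> closed_annulus \<Longrightarrow> poly q' z \<noteq> 0"
      using rational_functionsE[OF g(1)] by blast
    have "(\<lambda>z. poly (p * q' + p' * q) z / poly (q * q') z) \<in> rational_functions r"
      using pq(2) pq'(2) by (intro rational_functionsI) simp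
    moreover have "L2_add M F G = L2_class M (\<lambda>z. poly (p * q' + p' * q) z / poly (q * q') z)"
    proof -
      have "AE z in M. f z + g z = poly (p * q' + p' * q) z / poly (q * q') z"
        using AE_boundary
      proof eventually_elim
        case (elim z)
        then have "poly q z \<noteq> 0" "poly q' z \<noteq> 0"
          using pq(2) pq'(2) r_less_1 by auto
        then show ?case
          by (simp add: pq(1) pq'(1) add_frac_eq)
      qed
      then show ?thesis
        using f g L2_fun_rational by (simp add: L2_add_class L2_class_cong_AE)
    qed
    ultimately show ?thesis by blast
  qed
qed

lemma zpow_in_hardy [simp]: "zpow m \<in> H"
proof -
  have "(\<lambda>z. z powi m) \<in> rational_functions r"
  proof (cases "m \<ge> 0")
    case True
    have "(\<lambda>z. poly (monom 1 (nat m)) z / poly 1 z) \<in> rational_functions r"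
      by (rule rational_functionsI) simp
    with True show ?thesis
      by (simp add: poly_monom power_int_def)
  next
    case False
    have "(\<lambda>z. poly 1 z / poly (monom 1 (nat (- m))) z) \<in> rational_functions r"
      using r_pos by (intro rational_functionsI) (auto simp: poly_monom)
    with False show ?thesis
      by (simp add: poly_monom power_int_def field_simps)
  qed
  moreover have "L2_class M ` rational_functions r \<subseteq> H"
    unfolding hardy_space_def using L2_fun_rational by (intro L2_closure_superset) auto
  ultimately show ?thesis
    by (auto simp: zpow_def)
qed

lemma hardy_subset_L2: "H \<subseteq> L2 M"
  using closed_subspaceD(1)[OF closed_subspace_hardy] .

text \<open>Uniform approximation on the closed annulus implies approximation in the mean, because the boundary has
  finite length, and a Laurent polynomial is a linear combination of monomials.\<close>

lemma hardy_least:
  assumes S: "closed_subspace M S" and zpow: "\<And>m. zpow m \<in> S"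
  shows "H \<subseteq> S"
proof -
  have laurent: "(\<lambda>z. poly p z / z ^ k) \<in> L2_fun M \<and> L2_class M (\<lambda>z. poly p z / z ^ k) \<in> S" for p k
  proof
    let ?s = "\<lambda>z. \<Sum>i\<le>degree p. coeff p i * z powi (int i - int k)"
    have s: "?s \<in> L2_fun M \<and> L2_class M ?s \<in> S"
      using zpow by (intro closed_subspace_class_sum[OF S]) (simp_all add: zpow_def)
    show L: "(\<lambda>z. poly p z / z ^ k) \<in> L2_fun M"
      using r_pos by (intro L2_fun_continuous) (auto intro!: continuous_intros)
    have "AE z in M. poly p z / z ^ k = ?s z"
      using AE_boundary_nonzero
      by eventually_elim (simp add: poly_altdef sum_divide_distrib power_int_diff)
    then have "L2_class M (\<lambda>z. poly p z / z ^ k) = L2_class M ?s"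
      by (rule L2_class_cong_AE)
    with s show "L2_class M (\<lambda>z. poly p z / z ^ k) \<in> S"
      by (simp only:)
  qed
  have "L2_class M f \<in> S" if f: "f \<in> rational_functions r" for f
  proof -
    have "L2_class M f \<in> L2_closure M S"
    proof (rule L2_closure_classI[OF L2_fun_rational[OF f]])
      fix e :: real assume e: "e > 0"
      define c where "c = measure M UNIV + 1"
      have c: "c > 0" "c > measure M UNIV" by (simp_all add: c_def add_nonneg_pos)
      have "sqrt (e / c) > 0" using e c by simp
      then obtain p k where pk: "\<And>z. z \<in> closed_annulus \<Longrightarrow> cmod (f z - poly p z / z ^ k) \<le> sqrt (e / c)"
        using laurent_approximable_rational[OF f] unfolding laurent_approximable_def by blast
      have "sqnorm M (\<lambda>z. f z - poly p z / z ^ k) \<le> (sqrt (e / c))\<^sup>2 * measure M UNIV"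
        using pk laurent[of p k] by (intro sqnorm_le_bounded L2_fun_diff L2_fun_rational[OF f]) auto
      also have "\<dots> = (e / c) * measure M UNIV"
        using e c by simp
      also have "\<dots> < (e / c) * c"
        using e c by (intro mult_strict_left_mono) auto
      also have "\<dots> = e"
        using c by simp
      finally show "\<exists>g. g \<in> L2_fun M \<and> L2_class M g \<in> S \<and> sqnorm M (\<lambda>z. f z - g z) < e"
        using laurent by blast
    qed
    then show ?thesis
      using closed_subspaceD(5)[OF S] by simp
  qed
  then have "L2_class M ` rational_functions r \<subseteq> S" by blast
  from L2_closure_mono[OF this, of M] show ?thesis
    unfolding hardy_space_def closed_subspaceD(5)[OF S] .
qed

text \<open>The annihilator of the difference \<open>F - G\<close> is a closed subspace that contains all monomials, hence the
  whole Hardy space, and in particular \<open>F - G\<close> itself.\<close>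

lemma hardy_eqI:
  assumes F: "F \<in> H" and G: "G \<in> H" and eq: "\<And>m. L2_inner M F (zpow m) = L2_inner M G (zpow m)"
  shows "F = G"
proof -
  obtain f where f: "f \<in> L2_fun M" "F = L2_class M f"
    using F hardy_subset_L2 by (auto elim: L2_cases)
  obtain g where g: "g \<in> L2_fun M" "G = L2_class M g"
    using G hardy_subset_L2 by (auto elim: L2_cases)
  let ?D = "L2_class M (\<lambda>z. f z - g z)"
  have D: "?D \<in> H" "?D \<in> L2 M"
    using closed_subspace_class_diff[OF closed_subspace_hardy f(1) _ g(1)] F G f g by auto
  have inner_D: "L2_inner M ?D X = L2_inner M F X - L2_inner M G X" if X: "X \<in> L2 M" for X
  proof -
    obtain x where "x \<in> L2_fun M" "X = L2_class M x"
      using X by (auto elim: L2_cases)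
    then show ?thesis
      using f g by (simp add: L2_inner_class left_diff_distrib)
  qed
  have "H \<subseteq> {X \<in> L2 M. \<forall>Y\<in>{?D}. L2_inner M X Y = 0}"
  proof (rule hardy_least)
    show "closed_subspace M {X \<in> L2 M. \<forall>Y\<in>{?D}. L2_inner M X Y = 0}"
      using D by (intro closed_subspace_annihilator) auto
    show "zpow m \<in> {X \<in> L2 M. \<forall>Y\<in>{?D}. L2_inner M X Y = 0}" for m
      using inner_D[of "zpow m"] eq[of m] L2_inner_commute[of "zpow m" M ?D] D by simp
  qed
  then have "L2_inner M X ?D = 0" if "X \<in> H" for X
    using that by blast
  then have zero: "L2_inner M ?D X = 0" if "X \<in> H" for X
    using that D hardy_subset_L2 L2_inner_commute[of ?D M X] by auto
  show ?thesis
  proof (rule L2_eqI[OF closed_subspace_hardy F G])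
    fix X assume "X \<in> H"
    then show "L2_inner M F X = L2_inner M G X"
      using zero inner_D[of X] hardy_subset_L2 by auto
  qed
qed

end

section \<open>The Toeplitz operator and its adjoint\<close>

locale hardy_toeplitz = hardy_annulus +
  fixes n :: nat
  assumes n_pos: "n > 0"
begin

abbreviation T where "T \<equiv> toeplitz_power r n"
abbreviation Tadj where "Tadj \<equiv> adjoint_in M H T"

lemma L2_fun_mult_contraction:
  assumes \<phi>: "\<phi> \<in> borel_measurable borel" "\<And>z. cmod z \<le> 1 \<Longrightarrow> cmod (\<phi> z) \<le> 1" and f: "f \<in> L2_fun M"
  shows "(\<lambda>z. \<phi> z * f z) \<in> L2_fun M" "sqnorm M (\<lambda>z. \<phi> z * f z) \<le> sqnorm M f"
proof -
  have le: "AE z in M. (cmod (\<phi> z * f z))\<^sup>2 \<le> (cmod (f z))\<^sup>2"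
    using AE_boundary
  proof eventually_elim
    case (elim z)
    then have "cmod (\<phi> z) \<le> 1"
      using \<phi>(2) r_less_1 by auto
    then show ?case
      by (intro power_mono) (auto simp: norm_mult mult_left_le_one_le)
  qed
  show L: "(\<lambda>z. \<phi> z * f z) \<in> L2_fun M"
    by (rule L2_funI_bound[OF _ L2_fun_integrable[OF f] le]) (use \<phi>(1) L2_fun_measurable[OF f] in simp)
  show "sqnorm M (\<lambda>z. \<phi> z * f z) \<le> sqnorm M f"
    by (rule integral_mono_AE[OF L2_fun_integrable[OF L] L2_fun_integrable[OF f] le])
qed

lemma L2_fun_power_mult:
  assumes "f \<in> L2_fun M"
  shows "(\<lambda>z. z ^ n * f z) \<in> L2_fun M" "(\<lambda>z. cnj z ^ n * f z) \<in> L2_fun M"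
    "sqnorm M (\<lambda>z. z ^ n * f z) \<le> sqnorm M f"
  using assms by (auto intro!: L2_fun_mult_contraction simp: norm_power power_le_one)

lemma T_class:
  assumes f: "f \<in> L2_fun M"
  shows "T (L2_class M f) = L2_class M (\<lambda>z. z ^ n * f z)"
  unfolding toeplitz_power_def using L2_rep_class(2)[OF f] by (intro L2_class_cong_AE) auto

lemma T_zpow [simp]: "T (zpow m) = zpow (m + int n)"
proof -
  have "AE z in M. z ^ n * z powi m = z powi (m + int n)"
    using AE_boundary_nonzero by eventually_elim (simp add: power_int_add mult.commute)
  then show ?thesis
    unfolding zpow_def by (simp add: T_class L2_class_cong_AE)
qed

text \<open>The elements that \<open>T\<close> maps into the Hardy space form a closed subspace, because multiplication by
  \<open>z\<^sup>n\<close> is a contraction on the boundary, and it contains the monomials.\<close>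

lemma T_in_hardy:
  assumes "F \<in> H"
  shows "T F \<in> H"
proof -
  let ?S = "{F \<in> L2 M. T F \<in> H}"
  note H = closed_subspaceD[OF closed_subspace_hardy]
  have "H \<subseteq> ?S"
  proof (rule hardy_least)
    show "zpow m \<in> ?S" for m by simp
    show "closed_subspace M ?S"
    proof (rule closed_subspaceI)
      show "L2_zero M \<in> ?S"
        using H(2) by (simp add: L2_zero_def T_class)
      show "L2_add M F G \<in> ?S" if FG: "F \<in> ?S" "G \<in> ?S" for F G
      proof -
        obtain f where f: "f \<in> L2_fun M" "F = L2_class M f"
          using FG by (auto elim: L2_cases)
        obtain g where g: "g \<in> L2_fun M" "G = L2_class M g"
          using FG by (auto elim: L2_cases)
        have "T (L2_add M F G) = L2_add M (T F) (T G)"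
          using f g by (simp add: L2_add_class T_class L2_fun_power_mult distrib_left)
        then show ?thesis
          using FG H(3) by simp
      qed
      show "L2_scale M c F \<in> ?S" if F: "F \<in> ?S" for c F
      proof -
        obtain f where f: "f \<in> L2_fun M" "F = L2_class M f"
          using F by (auto elim: L2_cases)
        have "T (L2_scale M c F) = L2_scale M c (T F)"
          using f by (simp add: L2_scale_class T_class L2_fun_power_mult mult.left_commute)
        then show ?thesis
          using F H(4) by simp
      qed
      show "L2_closure M ?S \<subseteq> ?S"
      proof
        fix F assume F: "F \<in> L2_closure M ?S"
        obtain f where f: "f \<in> L2_fun M" "F = L2_class M f"
          and fa: "\<And>e. e > 0 \<Longrightarrow> \<exists>g. g \<in> L2_fun M \<and> L2_class M g \<in> ?S \<and> sqnorm M (\<lambda>z. f z - g z) < e"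
          by (rule L2_closure_classE[OF F]) auto
        have "L2_class M (\<lambda>z. z ^ n * f z) \<in> L2_closure M H"
        proof (rule L2_closure_classI)
          fix e :: real assume "e > 0"
          then obtain g where g: "g \<in> L2_fun M" "L2_class M g \<in> ?S" "sqnorm M (\<lambda>z. f z - g z) < e"
            using fa by blast
          have "sqnorm M (\<lambda>z. z ^ n * f z - z ^ n * g z) = sqnorm M (\<lambda>z. z ^ n * (f z - g z))"
            by (simp only: right_diff_distrib)
          also have "\<dots> \<le> sqnorm M (\<lambda>z. f z - g z)"
            by (rule L2_fun_power_mult(3)[OF L2_fun_diff[OF f(1) g(1)]])
          finally have "sqnorm M (\<lambda>z. z ^ n * f z - z ^ n * g z) < e"
            using g(3) by linarith
          then show "\<exists>h. h \<in> L2_fun M \<and> L2_class M h \<in> H \<and> sqnorm M (\<lambda>z. z ^ n * f z - h z) < e"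
            using g L2_fun_power_mult(1)[OF g(1)] by (intro exI[of _ "\<lambda>z. z ^ n * g z"]) (simp add: T_class)
        qed (rule L2_fun_power_mult(1)[OF f(1)])
        then show "F \<in> ?S"
          using f H(5) by (simp add: T_class)
      qed
    qed auto
  qed
  with assms show ?thesis by blast
qed

text \<open>In \<open>L\<^sup>2\<close> the adjoint is multiplication by the conjugate of \<open>z\<^sup>n\<close>, which does not preserve the Hardy space;
  the adjoint in the Hardy space is its compression.\<close>

lemma adjoint_exists:
  assumes G: "G \<in> H"
  shows "\<exists>A. A \<in> H \<and> (\<forall>F\<in>H. L2_inner M (T F) G = L2_inner M F A)"
proof -
  obtain g where g: "g \<in> L2_fun M" "G = L2_class M g"
    using G hardy_subset_L2 by (auto elim: L2_cases)
  let ?G = "L2_class M (\<lambda>z. cnj z ^ n * g z)"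
  have G': "?G \<in> L2 M"
    using g L2_fun_power_mult by simp
  obtain A where A: "A \<in> H" "\<And>F. F \<in> H \<Longrightarrow> L2_inner M ?G F = L2_inner M A F"
    using projection[OF closed_subspace_hardy G'] by blast
  have "L2_inner M (T F) G = L2_inner M F A" if "F \<in> H" for F
  proof -
    obtain f where f: "f \<in> L2_fun M" "F = L2_class M f"
      using \<open>F \<in> H\<close> hardy_subset_L2 by (auto elim: L2_cases)
    have "L2_inner M (T F) G = L2_inner M F ?G"
      using f g L2_fun_power_mult by (simp add: T_class L2_inner_class mult_ac)
    also have "\<dots> = L2_inner M F A"
      using A \<open>F \<in> H\<close> hardy_subset_L2 G' L2_inner_commute[of F M] by (simp add: subset_iff)
    finally show ?thesis .
  qed
  with A(1) show ?thesis
    by blast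
qed

lemma adjoint:
  assumes G: "G \<in> H"
  shows "Tadj G \<in> H" "F \<in> H \<Longrightarrow> L2_inner M (T F) G = L2_inner M F (Tadj G)"
proof -
  have "\<exists>!A. A \<in> H \<and> (\<forall>F\<in>H. L2_inner M (T F) G = L2_inner M F A)"
  proof (rule ex_ex1I)
    show "\<exists>A. A \<in> H \<and> (\<forall>F\<in>H. L2_inner M (T F) G = L2_inner M F A)"
      by (rule adjoint_exists[OF G])
    fix A B
    assume A: "A \<in> H \<and> (\<forall>F\<in>H. L2_inner M (T F) G = L2_inner M F A)"
      and B: "B \<in> H \<and> (\<forall>F\<in>H. L2_inner M (T F) G = L2_inner M F B)"
    show "A = B"
    proof (rule L2_eqI[OF closed_subspace_hardy])
      fix F assume "F \<in> H"
      then show "L2_inner M A F = L2_inner M B F"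
        using A B hardy_subset_L2 L2_inner_commute[of _ M F] by (metis subsetD)
    qed (use A B in auto)
  qed
  from theI'[OF this] show "Tadj G \<in> H" "F \<in> H \<Longrightarrow> L2_inner M (T F) G = L2_inner M F (Tadj G)"
    unfolding adjoint_in_def by auto
qed

lemma adjoint_right:
  assumes "G \<in> H" "F \<in> H"
  shows "L2_inner M (Tadj G) F = L2_inner M G (T F)"
  using adjoint[OF assms(1)] T_in_hardy assms hardy_subset_L2
    L2_inner_commute[of "Tadj G" M F] L2_inner_commute[of G M "T F"] by (metis subsetD)

lemma adjoint_zpow: "Tadj (zpow m) = L2_scale M (of_real (weight m / weight (m - int n))) (zpow (m - int n))"
proof (rule hardy_eqI)
  show "L2_scale M (of_real (weight m / weight (m - int n))) (zpow (m - int n)) \<in> H"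
    by (intro closed_subspaceD(4)[OF closed_subspace_hardy]) simp
  show "L2_inner M (Tadj (zpow m)) (zpow j) =
      L2_inner M (L2_scale M (of_real (weight m / weight (m - int n))) (zpow (m - int n))) (zpow j)" for j
    using weight_pos[of "m - int n"] by (auto simp: adjoint_right L2_inner_scale_left inner_zpow)
qed (simp add: adjoint)

text \<open>The eigenvalue of \<open>T\<^sup>*T\<close> at \<open>z\<^sup>m\<close>.\<close>

definition eigenvalue :: "int \<Rightarrow> real" where
  "eigenvalue m = weight (m + int n) / weight m"

lemma adjoint_T_zpow: "Tadj (T (zpow m)) = L2_scale M (of_real (eigenvalue m)) (zpow m)"
  by (simp add: adjoint_zpow eigenvalue_def)

lemma eigenvalue_inj:
  assumes "eigenvalue i = eigenvalue j"
  shows "i = j"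
proof -
  define c where "c = r powi (2 * int n)"
  define x y where "x = r powi (2 * i + 1)" and "y = r powi (2 * j + 1)"
  have "c < 1"
    using power_int_strict_decreasing[of 0 "2 * int n" r] n_pos r_pos r_less_1 by (simp add: c_def)
  have shift: "weight (m + int n) = 2 * pi * (1 + c * r powi (2 * m + 1))" for m
  proof -
    have "r powi (2 * (m + int n) + 1) = r powi (2 * int n + (2 * m + 1))"
      by (simp add: algebra_simps)
    also have "\<dots> = c * r powi (2 * m + 1)"
      unfolding c_def using r_pos by (intro power_int_add) simp
    finally show ?thesis by (simp add: weight_def)
  qed
  have pos: "x > 0" "y > 0"
    using r_pos by (simp_all add: x_def y_def)
  have "weight (i + int n) * weight j = weight (j + int n) * weight i"
    using assms weight_pos[of i] weight_pos[of j] by (simp add: eigenvalue_def frac_eq_eq)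
  then have "(2 * pi) * (2 * pi) * ((1 + c * x) * (1 + y)) = (2 * pi) * (2 * pi) * ((1 + c * y) * (1 + x))"
    unfolding shift unfolding weight_def x_def y_def by (simp only: mult_ac)
  then have "(1 + c * x) * (1 + y) = (1 + c * y) * (1 + x)"
    by (subst (asm) mult_cancel_left) simp
  then have "(1 - c) * (x - y) = 0"
    by (simp add: algebra_simps)
  then have "x = y"
    using \<open>c < 1\<close> by simp
  then show ?thesis
    using power_int_strict_decreasing[of "2 * i + 1" "2 * j + 1" r] power_int_strict_decreasing[of "2 * j + 1" "2 * i + 1" r]
      r_pos r_less_1 unfolding x_def y_def by (cases i j rule: linorder_cases) auto
qed

subsection \<open>Reducing subspaces\<close>

text \<open>The coordinate subspaces of the orthogonal basis of monomials. Membership is expressed by vanishing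
  coefficients rather than as a closed span, so that being closed and being invariant can be read off from inner products;
  \<open>coord_least\<close> shows that the two descriptions agree.\<close>

definition coord :: "int set \<Rightarrow> (complex \<Rightarrow> complex) set set" where
  "coord J = {F \<in> H. \<forall>m. m \<notin> J \<longrightarrow> L2_inner M F (zpow m) = 0}"

lemma coord_subset_hardy: "coord J \<subseteq> H"
  by (auto simp: coord_def)

lemma closed_subspace_coord: "closed_subspace M (coord J)"
proof -
  have "coord J = H \<inter> {F \<in> L2 M. \<forall>G\<in>zpow ` (- J). L2_inner M F G = 0}"
    using hardy_subset_L2 by (auto simp: coord_def)
  moreover have "zpow ` (- J) \<subseteq> L2 M" by auto
  ultimately show ?thesis
    using closed_subspace_Int[OF closed_subspace_hardy closed_subspace_annihilator] by (simp only:)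
qed

lemma zpow_in_coord_iff [simp]: "zpow m \<in> coord J \<longleftrightarrow> m \<in> J"
  using weight_pos[of m] by (auto simp: coord_def inner_zpow)

lemma coord_subset_iff: "coord J \<subseteq> coord J' \<longleftrightarrow> J \<subseteq> J'"
proof
  show "coord J \<subseteq> coord J' \<Longrightarrow> J \<subseteq> J'"
    using zpow_in_coord_iff by blast
qed (auto simp: coord_def)

lemma coord_empty: "coord {} = {L2_zero M}"
proof -
  have "F = L2_zero M" if "F \<in> coord {}" for F
    using that closed_subspaceD(2)[OF closed_subspace_hardy]
    by (intro hardy_eqI) (auto simp: coord_def)
  then show ?thesis
    using closed_subspaceD(2)[OF closed_subspace_coord] by auto
qed

text \<open>The projection of \<open>F\<close> to \<open>S \<inter> coord J\<close> has the same coefficients as \<open>F\<close>: on \<open>J\<close> because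
  those monomials lie in the subspace projected to, off \<open>J\<close> because both coefficients vanish.\<close>

lemma coord_least:
  assumes S: "closed_subspace M S" and J: "\<And>m. m \<in> J \<Longrightarrow> zpow m \<in> S"
  shows "coord J \<subseteq> S"
proof
  fix F assume F: "F \<in> coord J"
  have V: "closed_subspace M (S \<inter> coord J)"
    by (intro closed_subspace_Int S closed_subspace_coord)
  have FL2: "F \<in> L2 M"
    using F hardy_subset_L2 by (auto simp: coord_def)
  obtain Q where Q: "Q \<in> S \<inter> coord J" "\<And>G. G \<in> S \<inter> coord J \<Longrightarrow> L2_inner M F G = L2_inner M Q G"
    using projection[OF V FL2] by blast
  have "F = Q"
  proof (rule hardy_eqI)
    show "L2_inner M F (zpow m) = L2_inner M Q (zpow m)" for m
    proof (cases "m \<in> J")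
      case True
      then show ?thesis
        using J by (intro Q(2)) simp
    next
      case False
      then show ?thesis
        using Q(1) F by (simp add: coord_def)
    qed
  qed (use F Q in \<open>auto simp: coord_def\<close>)
  with Q show "F \<in> S" by simp
qed

lemma L2_scale_inverse_zpow:
  assumes "a * b = 1"
  shows "L2_scale M a (L2_scale M b (zpow m)) = zpow m"
  using assms by (simp add: zpow_def L2_scale_class flip: mult.assoc)

text \<open>The coefficients of \<open>T F\<close> and \<open>T\<^sup>* F\<close> at \<open>m\<close> are multiples of those of \<open>F\<close> at \<open>m - n\<close> and at
  \<open>m + n\<close>.\<close>

lemma reducing_coord:
  assumes J: "\<And>m. m + int n \<in> J \<longleftrightarrow> m \<in> J"
  shows "reducing_subspace M H T (coord J)"
  unfolding reducing_subspace_def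
proof (intro conjI ballI closed_subspace_coord coord_subset_hardy)
  fix F assume F: "F \<in> coord J"
  then have FH: "F \<in> H" and F0: "\<And>m. m \<notin> J \<Longrightarrow> L2_inner M F (zpow m) = 0"
    by (auto simp: coord_def)
  have "L2_inner M (T F) (zpow m) = 0" if "m \<notin> J" for m
  proof -
    have "m - int n \<notin> J"
      using J[of "m - int n"] that by simp
    then have "L2_inner M (zpow (m - int n)) F = 0"
      using F0 FH hardy_subset_L2 L2_inner_commute[of "zpow (m - int n)" M F] by auto
    then have "L2_inner M (Tadj (zpow m)) F = 0"
      using FH hardy_subset_L2 by (auto simp: adjoint_zpow L2_inner_scale_left)
    then have "L2_inner M F (Tadj (zpow m)) = 0"
      using FH hardy_subset_L2 adjoint(1)[of "zpow m"] L2_inner_commute[of F M "Tadj (zpow m)"] by auto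
    then show ?thesis
      using adjoint(2)[of "zpow m" F] FH by simp
  qed
  then show "T F \<in> coord J"
    using T_in_hardy[OF FH] by (simp add: coord_def)
  have "L2_inner M (Tadj F) (zpow m) = 0" if "m \<notin> J" for m
    using F0[of "m + int n"] J[of m] that FH by (simp add: adjoint_right)
  then show "Tadj F \<in> coord J"
    using adjoint(1)[OF FH] by (simp add: coord_def)
qed

text \<open>Let \<open>Q\<close> be the projection of \<open>z\<^sup>m\<close> to \<open>S\<close>. As \<open>S\<close> is invariant under the self-adjoint operator
  \<open>T\<^sup>*T\<close>, the projection commutes with it, so \<open>Q\<close> is an eigenvector (or zero) for the eigenvalue of \<open>z\<^sup>m\<close>.
  Eigenvectors for different eigenvalues are orthogonal, so that only the coefficient of \<open>Q\<close> at \<open>m\<close>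
  can differ from zero.\<close>

lemma reducing_zpow_dichotomy:
  assumes S: "reducing_subspace M H T S"
  shows "zpow m \<in> S \<or> (\<forall>F\<in>S. L2_inner M F (zpow m) = 0)"
proof -
  have cl: "closed_subspace M S" and SH: "S \<subseteq> H"
    and ST: "\<And>F. F \<in> S \<Longrightarrow> T F \<in> S" and SA: "\<And>F. F \<in> S \<Longrightarrow> Tadj F \<in> S"
    using S by (auto simp: reducing_subspace_def)
  note SL2 = closed_subspaceD(1)[OF cl]
  obtain Q where Q: "Q \<in> S" and proj: "\<And>F. F \<in> S \<Longrightarrow> L2_inner M (zpow m) F = L2_inner M Q F"
    using projection[OF cl zpow_in_L2] by blast
  have QH: "Q \<in> H" "Q \<in> L2 M"
    using Q SH SL2 by auto
  have eigen: "Tadj (T Q) = L2_scale M (of_real (eigenvalue m)) Q"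
  proof (rule L2_eqI[OF cl])
    show "Tadj (T Q) \<in> S" "L2_scale M (of_real (eigenvalue m)) Q \<in> S"
      using Q ST SA closed_subspaceD(4)[OF cl] by auto
    fix F assume F: "F \<in> S"
    then have FH: "F \<in> H" "F \<in> L2 M"
      using SH SL2 by auto
    have swap: "L2_inner M (Tadj (T X)) F = L2_inner M X (Tadj (T F))" if "X \<in> H" for X
      using that FH(1) by (simp add: adjoint_right adjoint(2)[symmetric] T_in_hardy)
    have "L2_inner M (Tadj (T Q)) F = L2_inner M Q (Tadj (T F))"
      by (rule swap[OF QH(1)])
    also have "\<dots> = L2_inner M (zpow m) (Tadj (T F))"
      using proj[OF SA[OF ST[OF F]]] by simp
    also have "\<dots> = L2_inner M (Tadj (T (zpow m))) F"
      by (rule swap[symmetric]) simp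
    also have "\<dots> = of_real (eigenvalue m) * L2_inner M (zpow m) F"
      using FH by (simp only: adjoint_T_zpow L2_inner_scale_left zpow_in_L2)
    also have "\<dots> = L2_inner M (L2_scale M (of_real (eigenvalue m)) Q) F"
      using FH QH proj[OF F] by (simp add: L2_inner_scale_left)
    finally show "L2_inner M (Tadj (T Q)) F = L2_inner M (L2_scale M (of_real (eigenvalue m)) Q) F" .
  qed
  have orth: "L2_inner M Q (zpow j) = 0" if "j \<noteq> m" for j
  proof -
    have "of_real (eigenvalue m) * L2_inner M Q (zpow j) = L2_inner M (Tadj (T Q)) (zpow j)"
      using QH by (simp add: eigen L2_inner_scale_left)
    also have "\<dots> = L2_inner M Q (Tadj (T (zpow j)))"
      using QH(1) by (simp add: adjoint_right adjoint(2)[symmetric] T_in_hardy del: T_zpow)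
    also have "\<dots> = cnj (L2_inner M (Tadj (T (zpow j))) Q)"
      using QH by (intro L2_inner_commute) (simp_all add: adjoint_T_zpow del: T_zpow)
    also have "\<dots> = of_real (eigenvalue j) * cnj (L2_inner M (zpow j) Q)"
      using QH by (simp add: adjoint_T_zpow L2_inner_scale_left del: T_zpow)
    also have "cnj (L2_inner M (zpow j) Q) = L2_inner M Q (zpow j)"
      using QH by (intro L2_inner_commute[symmetric]) simp_all
    finally have "L2_inner M Q (zpow j) = 0 \<or> eigenvalue m = eigenvalue j"
      by simp
    then show ?thesis
      using eigenvalue_inj[of m j] that by auto
  qed
  define c where "c = L2_inner M Q (zpow m) / of_real (weight m)"
  have Q_eq: "Q = L2_scale M c (zpow m)"
  proof (rule hardy_eqI)
    show "L2_scale M c (zpow m) \<in> H"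
      by (intro closed_subspaceD(4)[OF closed_subspace_hardy]) simp
    show "L2_inner M Q (zpow j) = L2_inner M (L2_scale M c (zpow m)) (zpow j)" for j
      using orth[of j] weight_pos[of m] by (cases "j = m") (simp_all add: L2_inner_scale_left inner_zpow c_def)
  qed (rule QH(1))
  show ?thesis
  proof (cases "c = 0")
    case True
    have "L2_inner M F (zpow m) = 0" if "F \<in> S" for F
    proof -
      have FL2: "F \<in> L2 M"
        using that SL2 by auto
      have "L2_inner M F (zpow m) = cnj (L2_inner M (zpow m) F)"
        using FL2 by (intro L2_inner_commute) simp_all
      also have "\<dots> = 0"
        using proj[OF that] FL2 True by (simp add: Q_eq L2_inner_scale_left)
      finally show ?thesis .
    qed
    then show ?thesis by blast
  next
    case False
    have "L2_scale M (1 / c) Q = zpow m"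
      using False by (simp add: Q_eq L2_scale_inverse_zpow)
    then show ?thesis
      using closed_subspaceD(4)[OF cl Q, of "1 / c"] by simp
  qed
qed

lemma reducing_eq_coord:
  assumes S: "reducing_subspace M H T S"
  shows "S = coord {m. zpow m \<in> S}" "zpow (m + int n) \<in> S \<longleftrightarrow> zpow m \<in> S"
proof -
  have cl: "closed_subspace M S" and SH: "S \<subseteq> H"
    and ST: "\<And>F. F \<in> S \<Longrightarrow> T F \<in> S" and SA: "\<And>F. F \<in> S \<Longrightarrow> Tadj F \<in> S"
    using S by (auto simp: reducing_subspace_def)
  show "S = coord {m. zpow m \<in> S}"
  proof
    show "S \<subseteq> coord {m. zpow m \<in> S}"
      using SH reducing_zpow_dichotomy[OF S] by (auto simp: coord_def)
    show "coord {m. zpow m \<in> S} \<subseteq> S"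
      by (rule coord_least[OF cl]) simp
  qed
  show "zpow (m + int n) \<in> S \<longleftrightarrow> zpow m \<in> S"
  proof
    assume "zpow (m + int n) \<in> S"
    then have "L2_scale M (of_real (1 / eigenvalue m)) (Tadj (T (zpow m))) \<in> S"
      using SA closed_subspaceD(4)[OF cl] by simp
    also have "L2_scale M (of_real (1 / eigenvalue m)) (Tadj (T (zpow m))) = zpow m"
    proof -
      have nz: "eigenvalue m \<noteq> 0"
        using weight_pos[of m] weight_pos[of "m + int n"] by (simp add: eigenvalue_def)
      then show ?thesis
        unfolding adjoint_T_zpow by (intro L2_scale_inverse_zpow) (simp flip: of_real_mult)
    qed
    finally show "zpow m \<in> S" .
  next
    assume "zpow m \<in> S"
    then show "zpow (m + int n) \<in> S"
      using ST[of "zpow m"] by simp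
  qed
qed

subsection \<open>Counting\<close>

definition with_residue :: "nat set \<Rightarrow> int set" where
  "with_residue A = {m. nat (m mod int n) \<in> A}"

lemma with_residue_subset_iff:
  assumes "A \<subseteq> {0..<n}"
  shows "with_residue A \<subseteq> with_residue B \<longleftrightarrow> A \<subseteq> B"
proof
  assume sub: "with_residue A \<subseteq> with_residue B"
  show "A \<subseteq> B"
  proof
    fix k assume k: "k \<in> A"
    with assms have "k < n" by auto
    then have "int k mod int n = int k" by simp
    with k have "int k \<in> with_residue A" by (simp add: with_residue_def)
    with sub have "int k \<in> with_residue B" by blast
    with \<open>int k mod int n = int k\<close> show "k \<in> B" by (simp add: with_residue_def)
  qed
qed (auto simp: with_residue_def)

lemma periodic_eq_with_residue:
  assumes J: "\<And>m. m + int n \<in> J \<longleftrightarrow> m \<in> J"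
  shows "J = with_residue {k. k < n \<and> int k \<in> J}"
proof -
  have shift: "x + int n * q \<in> J \<longleftrightarrow> x \<in> J" for x q
  proof (induction q rule: int_induct[where k = 0])
    case (step1 i)
    then show ?case using J[of "x + int n * i"] by (simp add: algebra_simps)
  next
    case (step2 i)
    then show ?case using J[of "x + int n * (i - 1)"] by (simp add: algebra_simps)
  qed simp
  have "m \<in> J \<longleftrightarrow> m mod int n \<in> J" for m
    using shift[of "m mod int n" "m div int n"] by simp
  then show ?thesis
    using n_pos by (auto simp: with_residue_def nat_less_iff)
qed

definition reducing_of :: "nat set \<Rightarrow> (complex \<Rightarrow> complex) set set" where
  "reducing_of A = coord (with_residue A)"

lemma reducing_of_subset_iff:
  "A \<subseteq> {0..<n} \<Longrightarrow> reducing_of A \<subseteq> reducing_of B \<longleftrightarrow> A \<subseteq> B"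
  by (simp add: reducing_of_def coord_subset_iff with_residue_subset_iff)

lemma reducing_iff: "reducing_subspace M H T S \<longleftrightarrow> S \<in> reducing_of ` Pow {0..<n}"
proof
  assume S: "reducing_subspace M H T S"
  define J where "J = {m. zpow m \<in> S}"
  define A where "A = {k. k < n \<and> int k \<in> J}"
  have "S = coord J"
    unfolding J_def by (rule reducing_eq_coord(1)[OF S])
  moreover have "J = with_residue A"
    unfolding A_def by (rule periodic_eq_with_residue) (simp add: J_def reducing_eq_coord(2)[OF S])
  ultimately have "S = reducing_of A"
    unfolding reducing_of_def by (rule trans[OF _ arg_cong[of _ _ coord]])
  moreover have "A \<in> Pow {0..<n}"
    by (auto simp: A_def)
  ultimately show "S \<in> reducing_of ` Pow {0..<n}" by blast
next
  assume "S \<in> reducing_of ` Pow {0..<n}"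
  then show "reducing_subspace M H T S"
    by (auto simp: reducing_of_def with_residue_def intro!: reducing_coord)
qed

lemma inj_on_reducing_of: "inj_on reducing_of (Pow {0..<n})"
  by (rule inj_onI) (use reducing_of_subset_iff in \<open>metis PowD subset_antisym order_refl\<close>)

lemma card_reducing: "card {S. reducing_subspace M H T S} = 2 ^ n"
  by (simp add: reducing_iff card_image[OF inj_on_reducing_of] card_Pow)

lemma reducing_of_empty: "reducing_of {} = {L2_zero M}"
  by (simp add: reducing_of_def with_residue_def coord_empty)

lemma residue_subspace_eq:
  assumes "k < n"
  shows "residue_subspace r n k = reducing_of {k}"
proof -
  have residue: "m \<in> with_residue {k} \<longleftrightarrow> [m = int k] (mod int n)" for m
  proof -
    have "nat (m mod int n) = k \<longleftrightarrow> m mod int n = int k"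
      using n_pos by (auto simp: nat_eq_iff)
    then show ?thesis
      using assms by (simp add: with_residue_def cong_def)
  qed
  show ?thesis
  proof
    have "reducing_of {k} \<in> {S. closed_subspace M S \<and> S \<subseteq> H \<and>
        (\<forall>m. [m = int k] (mod int n) \<longrightarrow> L2_class M (\<lambda>z. z powi m) \<in> S)}"
      unfolding reducing_of_def zpow_def[symmetric]
      by (auto simp: closed_subspace_coord residue subsetD[OF coord_subset_hardy])
    then show "residue_subspace r n k \<subseteq> reducing_of {k}"
      unfolding residue_subspace_def by (rule Inter_lower)
    show "reducing_of {k} \<subseteq> residue_subspace r n k"
      unfolding residue_subspace_def reducing_of_def
      by (intro Inter_greatest coord_least) (auto simp: residue zpow_def)
  qed
qed

lemma minimal_reducing_iff:
  "minimal_reducing_subspace M H T S \<longleftrightarrow> S \<in> residue_subspace r n ` {0..<n}"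
proof
  assume min: "minimal_reducing_subspace M H T S"
  then obtain A where A: "A \<subseteq> {0..<n}" "S = reducing_of A"
    by (auto simp: minimal_reducing_subspace_def reducing_iff)
  have "A \<noteq> {}"
    using min A(2) by (auto simp: minimal_reducing_subspace_def reducing_of_empty)
  then obtain k where k: "k \<in> A" by blast
  then have kn: "{k} \<subseteq> {0..<n}"
    using A(1) by auto
  have "reducing_subspace M H T (reducing_of {k})"
    using kn by (auto simp: reducing_iff)
  moreover have "reducing_of {k} \<subseteq> S"
    using k kn A(2) by (simp add: reducing_of_subset_iff)
  ultimately have "reducing_of {k} = {L2_zero M} \<or> reducing_of {k} = S"
    using min unfolding minimal_reducing_subspace_def by blast
  moreover have "reducing_of {k} \<noteq> {L2_zero M}"
    using reducing_of_subset_iff[OF kn, of "{}"] by (auto simp: reducing_of_empty)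
  ultimately show "S \<in> residue_subspace r n ` {0..<n}"
    using kn residue_subspace_eq[of k] by auto
next
  assume "S \<in> residue_subspace r n ` {0..<n}"
  then obtain k where k: "k < n" "S = reducing_of {k}"
    by (auto simp: residue_subspace_eq)
  show "minimal_reducing_subspace M H T S"
    unfolding minimal_reducing_subspace_def
  proof (intro conjI allI impI)
    show "reducing_subspace M H T S"
      using k by (auto simp: reducing_iff)
    show "S \<noteq> {L2_zero M}"
      using reducing_of_subset_iff[of "{k}" "{}"] k by (auto simp: reducing_of_empty)
    fix S' assume S': "reducing_subspace M H T S' \<and> S' \<subseteq> S"
    then obtain A where A: "A \<subseteq> {0..<n}" "S' = reducing_of A"
      by (auto simp: reducing_iff)
    have "A \<subseteq> {k}"
      using S' A k by (simp add: reducing_of_subset_iff)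
    then have "A = {} \<or> A = {k}" by blast
    then show "S' = {L2_zero M} \<or> S' = S"
      using A k reducing_of_empty by auto
  qed
qed

end

theorem theorem10:
  fixes r :: real and n :: nat
  assumes "0 < r" and "r < 1" and "n \<ge> 2"
  shows "card {S. reducing_subspace (boundary_measure r) (hardy_space r) (toeplitz_power r n) S} = 2 ^ n
    \<and> {S. minimal_reducing_subspace (boundary_measure r) (hardy_space r) (toeplitz_power r n) S}
        = residue_subspace r n ` {0..<n}"
proof -
  interpret hardy_toeplitz r n
    by unfold_locales (use assms in auto)
  show ?thesis
    using card_reducing minimal_reducing_iff by auto
qed

end
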